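(* Consider the problem $\min_{x\in\mathbb{R}^N} g(x)+F(x)$, $F=\frac1n\sum_{i=1}^n f_i$, under the Problem Properties assumption, and the L-SVRG algorithm with expected update frequency $\eta\in(0,1]$ (see context). Let $L_{\max}=\max_iL_i$, $\bar L=\frac1n\sum_{i=1}^nL_i$, $D_U=4-3\frac{\mu}{L_{\max}}$ and $D_L=4-3\frac{\mu}{\bar L}$; these satisfy $4>D_U\ge D_L\ge1$. The maximal step-size $\lambda_{\max}$ (in the sense defined in the context) and the recommended step-size $\lambda^\star$ for L-SVRG are as follows. If $p_i=\frac1n$ for all $i$: $$\lambda_{\max}=\frac{2}{D_UL_{\max}},\qquad \lambda^\star=\frac{2}{D_UL_{\max}+\eta^{-1}\mu+\sqrt{(D_UL_{\max})^2+(\eta^{-1}\mu)^2}}.$$ If $p_i\propto L_i$ (i.e. $p_i=L_i/\sum_jL_j$): $$\lambda_{\max}=\frac{2}{D_L\bar L},\qquad \lambda^\star=\frac{2}{D_L\bar L+\eta^{-1}\mu+\sqrt{(D_L\bar L)^2+(\eta^{-1}\mu)^2}}.$$ In either case, when the step-size $\lambda=\lambda^\star$ is used, the iterates satisfy $\mathbb{E}\|x^k-x^\star\|^2\in\mathcal{O}\big((1-\mu\lambda^\star)^k\big)$, where $x^\star$ is the unique solution of the problem.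
   Context: Problem Properties: $g:\mathbb{R}^N\to\mathbb{R}\cup\{\infty\}$ is closed, convex and proper. For every $i\in\{1,\dots,n\}$, $f_i:\mathbb{R}^N\to\mathbb{R}$ is convex, differentiable and $L_i$-smooth. $F=\frac1n\sum_{i=1}^n f_i$ is $\mu$-strongly convex, differentiable and $L$-smooth with $L\le\frac1n\sum_{i=1}^nL_i$. Here a convex $f$ is $L$-smooth ($L>0$) if it is differentiable and $\langle\nabla f(x)-\nabla f(y),x-y\rangle\ge\frac1L\|\nabla f(x)-\nabla f(y)\|^2$ for all $x,y$ (equivalently, $\nabla f$ is $L$-Lipschitz), and $f$ is $\mu$-strongly convex ($\mu>0$) if $f-\frac\mu2\|\cdot\|^2$ is convex. The norm is Euclidean, and $\operatorname{prox}_{\lambda g}(z)=\arg\min_x \lambda g(x)+\frac12\|x-z\|^2$. L-SVRG algorithm: given $x^0\in\mathbb{R}^N$, initial dual points $y_i^0=\nabla f_i(\hat x)$ ($i=1,\dots,n$) for some common $\hat x\in\mathbb{R}^N$, a step-size $\lambda>0$ and $\eta\in(0,1]$, for $k=0,1,\dots$ sample $I^k\in\{1,\dots,n\}$ with $P(I^k=i)=p_i>0$ and $Q^k$ independently and uniformly from $[0,1]$ (samples independent and identically distributed over $k$), and set $$z^{k+1}=x^k-\tfrac{\lambda}{n}\Big(\tfrac1{p_{I^k}}(\nabla f_{I^k}(x^k)-y_{I^k}^k)+\sum_{i=1}^ny_i^k\Big),\quad x^{k+1}=\operatorname{prox}_{\lambda g}(z^{k+1}),$$ and, for all $i$, $y_i^{k+1}=\nabla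 f_i(x^k)$ if $Q^k<\eta$ and $y_i^{k+1}=y_i^k$ otherwise. Maximal step-size: if $\max_i\frac{L_i}{np_i}>\mu$, the supremum of all $\lambda>0$ for which there exists $\rho\in(0,\eta)$ with $\rho=\mu\lambda(2-\nu(\rho)\lambda)$, $\nu(\rho)=\mu+\big(\max_i\frac{L_i}{np_i}-\mu\big)\big(1+\sqrt{\frac{\eta}{\eta-\rho}}\big)^2$; if $\max_i\frac{L_i}{np_i}=\mu$, the supremum of all $\lambda>0$ with $\mu\lambda(2-\mu\lambda)\in(0,1]$ (this is the step-size condition guaranteeing linear convergence in the paper's convergence theorem for coherent dual updates). "Recommended step-size" is just a name for $\lambda^\star$; its guaranteed property is the stated rate. *)

theory Defs
  imports "HOL-Probability.Probability" "HOL-Library.Landau_Symbols"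
begin

section \<open>Convex analysis\<close>

definition ereal_epigraph :: "('a \<Rightarrow> ereal) \<Rightarrow> ('a \<times> real) set" where
  "ereal_epigraph g = {(x, r). g x \<le> ereal r}"

definition closed_convex_proper :: "('a::euclidean_space \<Rightarrow> ereal) \<Rightarrow> bool" where
  "closed_convex_proper g \<longleftrightarrow>
     (\<forall>x. g x \<noteq> -\<infinity>) \<and> (\<exists>x. g x \<noteq> \<infinity>) \<and>
     closed (ereal_epigraph g) \<and> convex (ereal_epigraph g)"

definition grad :: "('a::euclidean_space \<Rightarrow> real) \<Rightarrow> 'a \<Rightarrow> 'a" where
  "grad f x = (THE d. GDERIV f x :> d)"

definition smooth_fun :: "real \<Rightarrow> ('a::euclidean_space \<Rightarrow> real) \<Rightarrow> bool" where
  "smooth_fun L f \<longleftrightarrow>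
     L > 0 \<and> convex_on UNIV f \<and> (\<forall>x. f differentiable (at x)) \<and>
     (\<forall>x y. (grad f x - grad f y) \<bullet> (x - y) \<ge> 1 / L * (norm (grad f x - grad f y))\<^sup>2)"

definition strongly_convex :: "real \<Rightarrow> ('a::euclidean_space \<Rightarrow> real) \<Rightarrow> bool" where
  "strongly_convex \<mu> f \<longleftrightarrow> \<mu> > 0 \<and> convex_on UNIV (\<lambda>x. f x - \<mu> / 2 * (norm x)\<^sup>2)"

text \<open>The proximal operator of \<open>\<lambda>g\<close>. For \<open>\<lambda> > 0\<close> and \<open>g\<close> closed, convex and proper the
  minimiser exists and is unique, so the choice made by \<open>arg_min\<close> is immaterial.\<close>

definition prox :: "real \<Rightarrow> ('a::euclidean_space \<Rightarrow> ereal) \<Rightarrow> 'a \<Rightarrow> 'a" where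
  "prox lam g z = arg_min (\<lambda>x. ereal lam * g x + ereal (1 / 2 * (norm (x - z))\<^sup>2)) (\<lambda>_. True)"


section \<open>The optimisation problem\<close>

definition avg_fun :: "nat \<Rightarrow> (nat \<Rightarrow> 'a \<Rightarrow> real) \<Rightarrow> 'a \<Rightarrow> real" where
  "avg_fun n f x = 1 / real n * (\<Sum>i\<in>{1..n}. f i x)"

text \<open>\<open>L i\<close> is the smoothness constant of \<open>f i\<close>, and \<open>LF\<close> that of the average.\<close>

definition problem_properties ::
  "nat \<Rightarrow> (nat \<Rightarrow> 'a::euclidean_space \<Rightarrow> real) \<Rightarrow> ('a \<Rightarrow> ereal) \<Rightarrow> (nat \<Rightarrow> real) \<Rightarrow> real \<Rightarrow> real \<Rightarrow> bool"
  where
  "problem_properties n f g L LF \<mu> \<longleftrightarrow>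
     closed_convex_proper g \<and>
     (\<forall>i\<in>{1..n}. smooth_fun (L i) (f i)) \<and>
     strongly_convex \<mu> (avg_fun n f) \<and>
     smooth_fun LF (avg_fun n f) \<and>
     LF \<le> 1 / real n * (\<Sum>i\<in>{1..n}. L i)"

definition is_solution ::
  "nat \<Rightarrow> (nat \<Rightarrow> 'a::euclidean_space \<Rightarrow> real) \<Rightarrow> ('a \<Rightarrow> ereal) \<Rightarrow> 'a \<Rightarrow> bool" where
  "is_solution n f g x \<longleftrightarrow> is_arg_min (\<lambda>x. g x + ereal (avg_fun n f x)) (\<lambda>_. True) x"


section \<open>L-SVRG\<close>

text \<open>The primal iterate and the dual points after \<open>k\<close> steps, as a function of the sampled
  indices \<open>i\<close> and the sampled numbers \<open>q\<close>.\<close>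

primrec lsvrg ::
  "nat \<Rightarrow> (nat \<Rightarrow> 'a::euclidean_space \<Rightarrow> real) \<Rightarrow> ('a \<Rightarrow> ereal) \<Rightarrow> (nat \<Rightarrow> real) \<Rightarrow> real \<Rightarrow> real \<Rightarrow>
   'a \<Rightarrow> 'a \<Rightarrow> (nat \<Rightarrow> nat) \<Rightarrow> (nat \<Rightarrow> real) \<Rightarrow> nat \<Rightarrow> 'a \<times> (nat \<Rightarrow> 'a)" where
  "lsvrg n f g p lam \<eta> x0 xhat i q 0 = (x0, \<lambda>j. grad (f j) xhat)"
| "lsvrg n f g p lam \<eta> x0 xhat i q (Suc k) =
     (let (x, y) = lsvrg n f g p lam \<eta> x0 xhat i q k;
          z = x - (lam / real n) *\<^sub>R
                ((1 / p (i k)) *\<^sub>R (grad (f (i k)) x - y (i k)) + (\<Sum>j\<in>{1..n}. y j))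
      in (prox lam g z, \<lambda>j. if q k < \<eta> then grad (f j) x else y j))"

definition lsvrg_sampling ::
  "'w measure \<Rightarrow> nat \<Rightarrow> (nat \<Rightarrow> real) \<Rightarrow> (nat \<Rightarrow> 'w \<Rightarrow> nat) \<Rightarrow> (nat \<Rightarrow> 'w \<Rightarrow> real) \<Rightarrow> bool" where
  "lsvrg_sampling M n p I Q \<longleftrightarrow>
     prob_space M \<and>
     (\<forall>i\<in>{1..n}. p i > 0) \<and>
     (\<forall>k. \<forall>i\<in>{1..n}. measure M {\<omega> \<in> space M. I k \<omega> = i} = p i) \<and>
     (\<forall>k. distr M borel (Q k) = uniform_measure lborel {0..1}) \<and>
     (\<forall>k. prob_space.indep_var M (count_space {1..n}) (I k) borel (Q k)) \<and>
     prob_space.indep_vars M (\<lambda>_. count_space {1..n} \<Otimes>\<^sub>M borel) (\<lambda>k \<omega>. (I k \<omega>, Q k \<omega>)) UNIV"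

definition lsvrg_iterate ::
  "nat \<Rightarrow> (nat \<Rightarrow> 'a::euclidean_space \<Rightarrow> real) \<Rightarrow> ('a \<Rightarrow> ereal) \<Rightarrow> (nat \<Rightarrow> real) \<Rightarrow> real \<Rightarrow> real \<Rightarrow>
   'a \<Rightarrow> 'a \<Rightarrow> (nat \<Rightarrow> 'w \<Rightarrow> nat) \<Rightarrow> (nat \<Rightarrow> 'w \<Rightarrow> real) \<Rightarrow> nat \<Rightarrow> 'w \<Rightarrow> 'a" where
  "lsvrg_iterate n f g p lam \<eta> x0 xhat I Q k \<omega> =
     fst (lsvrg n f g p lam \<eta> x0 xhat (\<lambda>j. I j \<omega>) (\<lambda>j. Q j \<omega>) k)"

text \<open>Integrability is part of the claim because the Bochner integral of a non-integrable
  function is zero.\<close>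

definition mean_square_rate ::
  "'w measure \<Rightarrow> (nat \<Rightarrow> 'w \<Rightarrow> 'a::euclidean_space) \<Rightarrow> 'a \<Rightarrow> real \<Rightarrow> bool" where
  "mean_square_rate M X xs r \<longleftrightarrow>
     (\<forall>k. integrable M (\<lambda>\<omega>. (norm (X k \<omega> - xs))\<^sup>2)) \<and>
     (\<lambda>k. \<integral>\<omega>. (norm (X k \<omega> - xs))\<^sup>2 \<partial>M) \<in> O(\<lambda>k. r ^ k)"


section \<open>Step-sizes\<close>

definition nu :: "real \<Rightarrow> real \<Rightarrow> real \<Rightarrow> real \<Rightarrow> real" where
  "nu \<mu> \<eta> m \<rho> = \<mu> + (m - \<mu>) * (1 + sqrt (\<eta> / (\<eta> - \<rho>)))\<^sup>2"

definition weighted_max :: "nat \<Rightarrow> (nat \<Rightarrow> real) \<Rightarrow> (nat \<Rightarrow> real) \<Rightarrow> real" where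
  "weighted_max n L p = Max ((\<lambda>i. L i / (real n * p i)) ` {1..n})"

definition admissible_step :: "nat \<Rightarrow> (nat \<Rightarrow> real) \<Rightarrow> (nat \<Rightarrow> real) \<Rightarrow> real \<Rightarrow> real \<Rightarrow> real \<Rightarrow> bool" where
  "admissible_step n L p \<mu> \<eta> lam \<longleftrightarrow>
     lam > 0 \<and>
     (weighted_max n L p > \<mu> \<and>
        (\<exists>\<rho>. 0 < \<rho> \<and> \<rho> < \<eta> \<and> \<rho> = \<mu> * lam * (2 - nu \<mu> \<eta> (weighted_max n L p) \<rho> * lam))
      \<or> weighted_max n L p = \<mu> \<and> 0 < \<mu> * lam * (2 - \<mu> * lam) \<and> \<mu> * lam * (2 - \<mu> * lam) \<le> 1)"

text \<open>The supremum is taken in the extended reals, where it is meaningful without a separate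
  proof that the set is non-empty and bounded above.\<close>

definition max_step :: "nat \<Rightarrow> (nat \<Rightarrow> real) \<Rightarrow> (nat \<Rightarrow> real) \<Rightarrow> real \<Rightarrow> real \<Rightarrow> ereal" where
  "max_step n L p \<mu> \<eta> = (SUP lam \<in> {lam. admissible_step n L p \<mu> \<eta> lam}. ereal lam)"

end

theory Submission
  imports Defs
begin

text \<open>
  Put \<open>m = weighted_max n L p\<close>, which is \<open>Lmax\<close> for uniform sampling and \<open>Lbar\<close> for sampling
  proportional to \<open>L\<close>; in both cases \<open>\<mu> \<le> LF \<le> Lbar \<le> m\<close>.  The quantities
  \<open>DU * Lmax\<close> and \<open>DL * Lbar\<close> are then \<open>4 * m - 3 * \<mu>\<close>.

  The maximal step-size.  For \<open>m > \<mu>\<close> the function \<open>nu\<close> increases from \<open>4 * m - 3 * \<mu>\<close> at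
  \<open>\<rho> = 0\<close> to infinity at \<open>\<rho> = \<eta>\<close>, so by the intermediate value theorem the equation for \<open>\<rho>\<close> is
  solvable exactly for \<open>lam < 2 / (4 * m - 3 * \<mu>)\<close> (\<open>admissible_root_iff\<close>).  For \<open>m = \<mu>\<close> this bound is \<open>2 / \<mu>\<close>, which is
  also what the condition in that case amounts to.

  The solution.  A separating hyperplane gives \<open>g\<close> an affine minorant, hence \<open>g\<close> plus a function of
  quadratic growth has a minimiser (\<open>exists_minimiser_of_quadratic_growth\<close>).  This covers both the
  problem itself and the proximal operator.  Minimisers are characterised by subgradients
  (\<open>minimiser_imp_subgradient\<close>), whose monotonicity yields uniqueness of the solution and
  nonexpansiveness of the proximal operator.

  The rate.  Write \<open>d\<close> for the error \<open>x - xs\<close> and \<open>T\<close> for the inner product of the gradient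
  difference of the average with \<open>d\<close>.  The sampled direction has the right mean, and its variance is
  controlled by the variance of the weighted gradient errors at \<open>x\<close> and that of the dual points.
  The dual points are all refreshed at once, so adding a suitable multiple of their variance to
  the squared error gives a Lyapunov function whose expectation contracts: the primal part drops by
  \<open>lam * (2 - nu * lam) * T\<close>, with \<open>nu\<close> taken at \<open>\<rho> = \<mu> * lam\<close>, and \<open>T\<close> is at least \<open>\<mu>\<close> times the
  squared error (\<open>svrg_step_inequality\<close>, \<open>lsvrg_drift\<close>).  The recommended step-size satisfies
  \<open>nu * lam \<le> 1\<close> (\<open>recommended_step\<close>), so the contraction factor is \<open>1 - \<mu> * lam\<close>.  Independence of the
  fresh sample from the history makes the conditional statement a recursion for expectations
  (\<open>lsvrg_mean_square_rate\<close>).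
\<close>

section \<open>Gradients of convex functions\<close>

lemma GDERIV_grad:
  fixes f :: "'a::euclidean_space \<Rightarrow> real"
  assumes "f differentiable (at x)"
  shows "GDERIV f x :> grad f x"
proof -
  obtain f' where f': "(f has_derivative f') (at x)"
    using assms by (auto simp: differentiable_def)
  interpret bounded_linear f' by (rule has_derivative_bounded_linear[OF f'])
  define d where "d = (\<Sum>b\<in>Basis. f' b *\<^sub>R b)"
  have "f' h = inner h d" for h
  proof -
    have "f' h = f' (\<Sum>b\<in>Basis. inner h b *\<^sub>R b)"
      by (simp add: euclidean_representation)
    also have "\<dots> = inner h d"
      by (simp add: sum scaleR d_def inner_sum_right mult.commute)
    finally show ?thesis .
  qed
  then have "f' = (\<lambda>h. inner h d)" by (rule ext)
  then have d: "GDERIV f x :> d"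
    using f' by (simp add: gderiv_def)
  moreover have "e = d" if "GDERIV f x :> e" for e
  proof -
    have "(\<lambda>h. inner h e) = (\<lambda>h. inner h d)"
      using that d unfolding gderiv_def by (rule has_derivative_unique)
    then have "\<forall>h. inner h e = inner h d"
      by (intro allI) (rule fun_cong)
    then show ?thesis
      by (rule iffD1[OF vector_eq_ldot])
  qed
  ultimately show ?thesis
    unfolding grad_def by (rule theI[where P = "\<lambda>d. GDERIV f x :> d"])
qed

lemma grad_eqI:
  fixes f :: "'a::euclidean_space \<Rightarrow> real"
  assumes "GDERIV f x :> d"
  shows "grad f x = d"
proof -
  have "f differentiable (at x)"
    using assms by (auto simp: gderiv_def differentiable_def)
  then have "(\<lambda>h. inner h (grad f x)) = (\<lambda>h. inner h d)"
    using GDERIV_grad assms unfolding gderiv_def by (blast intro: has_derivative_unique)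
  then have "\<forall>h. inner h (grad f x) = inner h d"
    by (intro allI) (rule fun_cong)
  then show ?thesis
    by (rule iffD1[OF vector_eq_ldot])
qed

lemma grad_avg_fun:
  fixes f :: "nat \<Rightarrow> 'a::euclidean_space \<Rightarrow> real"
  assumes "\<And>i. i \<in> {1..n} \<Longrightarrow> f i differentiable (at x)"
  shows "grad (avg_fun n f) x = (1 / real n) *\<^sub>R (\<Sum>i\<in>{1..n}. grad (f i) x)"
proof (rule grad_eqI)
  have "((\<lambda>x. 1 / real n * (\<Sum>i\<in>{1..n}. f i x)) has_derivative
      (\<lambda>h. 1 / real n * (\<Sum>i\<in>{1..n}. inner h (grad (f i) x)))) (at x)"
    using GDERIV_grad[OF assms] unfolding gderiv_def
    by (intro has_derivative_mult_right has_derivative_sum)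
  then show "GDERIV (avg_fun n f) x :> (1 / real n) *\<^sub>R (\<Sum>i\<in>{1..n}. grad (f i) x)"
    by (simp add: gderiv_def avg_fun_def[abs_def] inner_sum_right)
qed

lemma GDERIV_along_line:
  fixes h :: "'a::euclidean_space \<Rightarrow> real"
  assumes "GDERIV h x :> d"
  shows "((\<lambda>t. h (x + t *\<^sub>R v)) has_real_derivative inner d v) (at 0)"
proof -
  have "((\<lambda>t. h (x + t *\<^sub>R v)) has_derivative (\<lambda>t. inner (t *\<^sub>R v) d)) (at 0)"
    by (rule has_derivative_compose[where g = h])
      (use assms in \<open>auto simp: gderiv_def intro!: derivative_eq_intros\<close>)
  moreover have "(\<lambda>t. inner (t *\<^sub>R v) d) = (*) (inner d v)"
    by (auto simp: inner_commute mult.commute)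
  ultimately show ?thesis
    unfolding has_field_derivative_def by simp
qed

text \<open>Restricted to the line through \<open>x\<close> and \<open>y\<close> this is the tangent inequality for a convex
  function of one real variable.\<close>

lemma convex_on_above_tangent:
  fixes h :: "'a::euclidean_space \<Rightarrow> real"
  assumes "convex_on UNIV h" and d: "GDERIV h x :> d"
  shows "h x + inner d (y - x) \<le> h y"
proof -
  define \<phi> where "\<phi> = (\<lambda>t::real. h (x + t *\<^sub>R (y - x)))"
  have "convex_on UNIV \<phi>"
  proof (rule convex_onI)
    fix t u v :: real assume t: "0 < t" "t < 1"
    have "x + ((1 - t) *\<^sub>R u + t *\<^sub>R v) *\<^sub>R (y - x)
        = (1 - t) *\<^sub>R (x + u *\<^sub>R (y - x)) + t *\<^sub>R (x + v *\<^sub>R (y - x))"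
      by (simp add: algebra_simps)
    then show "\<phi> ((1 - t) *\<^sub>R u + t *\<^sub>R v) \<le> (1 - t) * \<phi> u + t * \<phi> v"
      using convex_onD[OF assms(1), of t] t by (simp add: \<phi>_def)
  qed simp
  moreover have "(\<phi> has_real_derivative inner d (y - x)) (at 0)"
    unfolding \<phi>_def using d by (rule GDERIV_along_line)
  ultimately have "\<phi> 1 - \<phi> 0 \<ge> inner d (y - x) * (1 - 0)"
    by (intro convex_on_imp_above_tangent[of UNIV]) auto
  then show ?thesis
    by (simp add: \<phi>_def)
qed

lemma strongly_convex_above_parabola:
  fixes f :: "'a::euclidean_space \<Rightarrow> real"
  assumes "strongly_convex \<mu> f" and "f differentiable (at x)"
  shows "f x + inner (grad f x) (y - x) + \<mu> / 2 * (norm (y - x))\<^sup>2 \<le> f y"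
proof -
  have "GDERIV (\<lambda>x. f x - \<mu> / 2 * (norm x)\<^sup>2) x :> grad f x - \<mu> *\<^sub>R x"
    using GDERIV_grad[OF assms(2)] unfolding gderiv_def power2_norm_eq_inner
    by (auto intro!: derivative_eq_intros simp: inner_diff_right inner_commute fun_eq_iff field_simps)
  then have "f x - \<mu> / 2 * (norm x)\<^sup>2 + inner (grad f x - \<mu> *\<^sub>R x) (y - x)
      \<le> f y - \<mu> / 2 * (norm y)\<^sup>2"
    using assms(1) unfolding strongly_convex_def by (intro convex_on_above_tangent) auto
  then show ?thesis
    by (simp add: power2_norm_eq_inner algebra_simps inner_commute)
qed

lemma strongly_convex_strongly_monotone:
  fixes f :: "'a::euclidean_space \<Rightarrow> real"
  assumes "strongly_convex \<mu> f" and "\<And>x. f differentiable (at x)"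
  shows "\<mu> * (norm (x - y))\<^sup>2 \<le> inner (grad f x - grad f y) (x - y)"
  using strongly_convex_above_parabola[OF assms(1,2), of x y]
    strongly_convex_above_parabola[OF assms(1,2), of y x]
  by (simp add: norm_minus_commute[of y x] inner_diff_left inner_diff_right)

text \<open>By Cauchy-Schwarz the monotonicity bound gives \<open>\<mu> * norm d \<le> norm G\<close>, which is then used once
  more under Cauchy-Schwarz.  For gradients this is a lower bound on the squared gradient
  difference: it limits how much of a second moment can be variance.\<close>

lemma strongly_monotone_grad_norm:
  fixes d G :: "'a::real_inner"
  assumes "\<mu> > 0" and T: "\<mu> * (norm d)\<^sup>2 \<le> inner G d"
  shows "\<mu> * inner G d \<le> (norm G)\<^sup>2"
proof -
  have "\<mu> * norm d * norm d \<le> norm G * norm d"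
    using T norm_cauchy_schwarz[of G d] by (simp add: power2_eq_square)
  then have "\<mu> * norm d \<le> norm G"
    by (cases "d = 0") auto
  then have "norm G * (\<mu> * norm d) \<le> norm G * norm G"
    by (intro mult_left_mono) auto
  moreover have "\<mu> * inner G d \<le> \<mu> * (norm G * norm d)"
    using assms(1) norm_cauchy_schwarz by auto
  ultimately show ?thesis
    by (simp add: power2_eq_square mult_ac)
qed

text \<open>For two distinct points, here \<open>0\<close> and a basis vector, the squared gradient difference is
  bounded below by \<open>\<mu>\<close> times, and above by \<open>LF\<close> times, the same positive inner product.\<close>

lemma strong_convexity_le_smoothness:
  fixes f :: "'a::euclidean_space \<Rightarrow> real"
  assumes "strongly_convex \<mu> f" and "smooth_fun LF f"
  shows "\<mu> \<le> LF"
proof -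
  obtain b :: 'a where b: "b \<in> Basis" using nonempty_Basis by blast
  define G where "G = grad f b - grad f 0"
  have diff: "f differentiable (at x)" for x
    using assms(2) by (auto simp: smooth_fun_def)
  have "\<mu> > 0" "LF > 0"
    using assms by (auto simp: strongly_convex_def smooth_fun_def)
  have T: "\<mu> * (norm b)\<^sup>2 \<le> inner G b"
    using strongly_convex_strongly_monotone[OF assms(1) diff, of b 0] by (simp add: G_def)
  have pos: "0 < inner G b"
    using T b \<open>\<mu> > 0\<close> by auto
  have "\<mu> * inner G b \<le> (norm G)\<^sup>2"
    using strongly_monotone_grad_norm[OF \<open>\<mu> > 0\<close> T] .
  also have "(norm G)\<^sup>2 \<le> LF * inner G b"
  proof -
    have "1 / LF * (norm G)\<^sup>2 \<le> inner G (b - 0)"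
      using assms(2) unfolding smooth_fun_def G_def by blast
    then show ?thesis
      using \<open>LF > 0\<close> by (simp add: field_simps)
  qed
  finally show ?thesis
    using pos by simp
qed


section \<open>Subgradients, minimisers and the proximal operator\<close>

definition subgradient :: "('a::real_inner \<Rightarrow> ereal) \<Rightarrow> 'a \<Rightarrow> 'a \<Rightarrow> bool" where
  "subgradient g x v \<longleftrightarrow> (\<exists>r. g x = ereal r \<and> (\<forall>y. ereal (r + inner v (y - x)) \<le> g y))"

lemma subgradient_monotone:
  assumes "subgradient g x u" and "subgradient g y v"
  shows "0 \<le> inner (u - v) (x - y)"
proof -
  obtain r s where rs: "g x = ereal r" "g y = ereal s"
    and "\<forall>z. ereal (r + inner u (z - x)) \<le> g z" "\<forall>z. ereal (s + inner v (z - y)) \<le> g z"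
    using assms unfolding subgradient_def by blast
  then have "ereal (r + inner u (y - x)) \<le> ereal s" "ereal (s + inner v (x - y)) \<le> ereal r"
    by metis+
  then show ?thesis
    by (simp add: inner_diff_left inner_diff_right)
qed

lemma closed_convex_proper_finite_point:
  assumes "closed_convex_proper g"
  obtains x r where "g x = ereal r"
  using assms unfolding closed_convex_proper_def by (metis ereal_cases)

text \<open>A point strictly below the epigraph is separated from it by a hyperplane, which cannot be
  vertical because that point lies below a point of the epigraph.\<close>

lemma closed_convex_proper_affine_minorant:
  fixes g :: "'a::euclidean_space \<Rightarrow> ereal"
  assumes g: "closed_convex_proper g"
  obtains v b where "\<And>x. ereal (inner v x + b) \<le> g x"
proof -
  obtain x0 t0 where x0: "g x0 = ereal t0"
    using closed_convex_proper_finite_point[OF g] .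
  have E: "closed (ereal_epigraph g)" "convex (ereal_epigraph g)"
    using g by (auto simp: closed_convex_proper_def)
  have "(x0, t0 - 1) \<notin> ereal_epigraph g"
    by (simp add: ereal_epigraph_def x0)
  then obtain a k where "inner a (x0, t0 - 1) < k" and "\<forall>z\<in>ereal_epigraph g. k < inner a z"
    using separating_hyperplane_closed_point[OF E(2,1)] by blast
  moreover obtain u s where "a = (u, s)"
    by (cases a)
  ultimately have below: "inner u x0 + s * (t0 - 1) < k"
    and above: "\<And>x t. g x \<le> ereal t \<Longrightarrow> k < inner u x + s * t"
    by (auto simp: ereal_epigraph_def)
  have "s > 0"
    using below above[of x0 t0] x0 by (simp add: algebra_simps)
  have "ereal (inner (- (1 / s) *\<^sub>R u) x + k / s) \<le> g x" for x
  proof (cases "g x")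
    case (real t)
    then have "k < inner u x + s * t"
      using above by simp
    then show ?thesis
      using \<open>s > 0\<close> real by (simp add: field_simps)
  next
    case MInf
    then show ?thesis
      using g by (simp add: closed_convex_proper_def)
  qed simp
  then show thesis
    by (rule that)
qed

text \<open>The quadratic growth of the smooth term dominates an affine minorant of \<open>g\<close>, so that the
  part of the epigraph that competes with one given point is compact.  Minimising over the
  epigraph rather than over the domain replaces the lower semicontinuous \<open>g\<close> by a coordinate
  projection.\<close>

lemma exists_minimiser_of_quadratic_growth:
  fixes g :: "'a::euclidean_space \<Rightarrow> ereal" and F :: "'a \<Rightarrow> real"
  assumes g: "closed_convex_proper g" and cont: "continuous_on UNIV F" and "\<mu> > 0"
    and growth: "\<And>x. a + inner w x + \<mu> / 2 * (norm x)\<^sup>2 \<le> F x"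
  shows "\<exists>x. is_arg_min (\<lambda>x. g x + ereal (F x)) (\<lambda>_. True) x"
proof -
  obtain x0 t0 where x0: "g x0 = ereal t0"
    using closed_convex_proper_finite_point[OF g] .
  obtain v b where minorant: "\<And>x. ereal (inner v x + b) \<le> g x"
    using closed_convex_proper_affine_minorant[OF g] by blast
  define r0 where "r0 = F x0 + t0"
  define C where "C = ereal_epigraph g \<inter> {z. F (fst z) + snd z \<le> r0}"
  have contF: "continuous_on S (\<lambda>z::'a \<times> real. F (fst z) + snd z)" for S
    by (intro continuous_intros continuous_on_compose2[OF cont]) auto
  have "closed C"
    unfolding C_def using g contF
    by (intro closed_Int closed_Collect_le) (auto simp: closed_convex_proper_def)
  moreover have "bounded C"
  proof -
    define A where "A = norm (v + w) + \<bar>r0 - a - b\<bar>"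
    define R where "R = 1 + 2 / \<mu> * A"
    have "A \<ge> 0" by (simp add: A_def)
    then have "R \<ge> 1" using \<open>\<mu> > 0\<close> by (simp add: R_def)
    have "x \<in> cball 0 R \<and> t \<in> {b - norm v * R .. r0 - a + norm w * R}"
      if "(x, t) \<in> C" for x t
    proof -
      note minorant[of x]
      also have "g x \<le> ereal t"
        using that by (simp add: C_def ereal_epigraph_def)
      finally have 1: "inner v x + b \<le> t" by simp
      have 2: "F x + t \<le> r0" using that by (simp add: C_def)
      have "norm x \<le> R"
      proof (rule ccontr)
        assume "\<not> norm x \<le> R"
        then have "1 \<le> norm x" "R < norm x" using \<open>R \<ge> 1\<close> by auto
        have "inner (v + w) x \<ge> - (norm (v + w) * norm x)"
          using Cauchy_Schwarz_ineq2[of "v + w" x] by linarith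
        then have "\<mu> / 2 * (norm x)\<^sup>2 \<le> norm (v + w) * norm x + \<bar>r0 - a - b\<bar>"
          using 1 2 growth[of x] unfolding inner_add_left by linarith
        also have "\<dots> \<le> A * norm x"
          using \<open>1 \<le> norm x\<close> mult_left_mono[of 1 "norm x" "\<bar>r0 - a - b\<bar>"]
          by (simp add: A_def distrib_right)
        also have "\<dots> < \<mu> / 2 * R * norm x"
          using \<open>1 \<le> norm x\<close> \<open>\<mu> > 0\<close> by (intro mult_strict_right_mono) (auto simp: R_def field_simps)
        also have "\<dots> \<le> \<mu> / 2 * norm x * norm x"
          using \<open>R < norm x\<close> \<open>\<mu> > 0\<close> by (intro mult_right_mono mult_left_mono) auto
        finally show False
          by (simp add: power2_eq_square)
      qed
      have "- (norm v * R) \<le> inner v x" "- (norm w * R) \<le> inner w x"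
        using norm_cauchy_schwarz[of "- v" x] norm_cauchy_schwarz[of "- w" x] \<open>norm x \<le> R\<close>
          mult_left_mono[of "norm x" R "norm v"] mult_left_mono[of "norm x" R "norm w"]
        by auto
      moreover have "0 \<le> \<mu> / 2 * (norm x)\<^sup>2" using \<open>\<mu> > 0\<close> by simp
      ultimately show ?thesis
        using 1 2 growth[of x] \<open>norm x \<le> R\<close> by auto
    qed
    then have "C \<subseteq> cball 0 R \<times> {b - norm v * R .. r0 - a + norm w * R}"
      by auto
    then show ?thesis
      by (rule bounded_subset[rotated]) (intro bounded_Times bounded_cball bounded_closed_interval)
  qed
  ultimately have "compact C"
    by (simp add: compact_eq_bounded_closed)
  moreover have "(x0, t0) \<in> C"
    by (simp add: C_def ereal_epigraph_def x0 r0_def)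
  ultimately obtain z where z: "z \<in> C" "\<And>y. y \<in> C \<Longrightarrow> F (fst z) + snd z \<le> F (fst y) + snd y"
    using continuous_attains_inf[of C "\<lambda>z. F (fst z) + snd z"] contF by blast
  have "g (fst z) + ereal (F (fst z)) \<le> g y + ereal (F y)" for y
  proof (cases "g y")
    case (real t)
    have "F (fst z) + snd z \<le> F y + t"
    proof (cases "F y + t \<le> r0")
      case True
      then show ?thesis using z(2)[of "(y, t)"] real by (simp add: C_def ereal_epigraph_def)
    next
      case False
      then show ?thesis using z(1) by (auto simp: C_def)
    qed
    moreover have "g (fst z) \<le> ereal (snd z)"
      using z(1) by (auto simp: C_def ereal_epigraph_def)
    ultimately show ?thesis
      using real by (cases "g (fst z)") auto
  next
    case MInf
    then show ?thesis using g by (simp add: closed_convex_proper_def)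
  qed simp
  then show ?thesis
    unfolding is_arg_min_def by (metis not_le)
qed

text \<open>Moving from a minimiser towards another point changes \<open>g\<close> at most linearly, by convexity;
  the first-order change of \<open>F\<close> has to compensate for it.\<close>

lemma minimiser_imp_subgradient:
  fixes g :: "'a::euclidean_space \<Rightarrow> ereal"
  assumes g: "closed_convex_proper g"
    and min: "is_arg_min (\<lambda>x. g x + ereal (F x)) (\<lambda>_. True) x"
    and d: "GDERIV F x :> d"
  shows "subgradient g x (- d)"
proof -
  have min: "g x + ereal (F x) \<le> g y + ereal (F y)" for y
    using min by (auto simp: is_arg_min_def not_less)
  obtain x0 t0 where "g x0 = ereal t0"
    using closed_convex_proper_finite_point[OF g] .
  then obtain r where r: "g x = ereal r"
    using min[of x0] g by (cases "g x") (auto simp: closed_convex_proper_def)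
  have "ereal (r + inner (- d) (y - x)) \<le> g y" for y
  proof (cases "g y")
    case (real t)
    define \<psi> where "\<psi> = (\<lambda>s. F (x + s *\<^sub>R (y - x)) + s * (t - r))"
    have deriv: "(\<psi> has_real_derivative inner d (y - x) + (t - r)) (at 0)"
      unfolding \<psi>_def
      by (rule derivative_eq_intros GDERIV_along_line[OF d] refl)+ simp
    have nondecreasing: "\<psi> 0 \<le> \<psi> s" if "0 < s" "s < 1" for s
    proof -
      have "(1 - s) *\<^sub>R (x, r) + s *\<^sub>R (y, t) \<in> ereal_epigraph g"
        using g r real that unfolding closed_convex_proper_def
        by (intro convexD) (auto simp: ereal_epigraph_def)
      then have "g (x + s *\<^sub>R (y - x)) \<le> ereal ((1 - s) * r + s * t)"
        by (simp add: ereal_epigraph_def algebra_simps)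
      then have "g (x + s *\<^sub>R (y - x)) + ereal (F (x + s *\<^sub>R (y - x)))
          \<le> ereal ((1 - s) * r + s * t) + ereal (F (x + s *\<^sub>R (y - x)))"
        by (rule add_right_mono)
      then have "ereal r + ereal (F x) \<le> ereal ((1 - s) * r + s * t) + ereal (F (x + s *\<^sub>R (y - x)))"
        using min[of "x + s *\<^sub>R (y - x)"] unfolding r by (rule order_trans[rotated])
      then show ?thesis
        by (simp add: \<psi>_def algebra_simps)
    qed
    have "\<not> inner d (y - x) + (t - r) < 0"
    proof
      assume "inner d (y - x) + (t - r) < 0"
      then obtain \<epsilon> where "\<epsilon> > 0" and dec: "\<And>s. 0 < s \<Longrightarrow> s < \<epsilon> \<Longrightarrow> \<psi> (0 + s) < \<psi> 0"
        using DERIV_neg_dec_right[OF deriv] by blast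
      define s where "s = min \<epsilon> 1 / 2"
      have "0 < s" "s < \<epsilon>" "s < 1"
        using \<open>\<epsilon> > 0\<close> by (auto simp: s_def)
      then show False
        using nondecreasing[of s] dec[of s] by simp
    qed
    then show ?thesis
      using real by simp
  next
    case MInf
    then show ?thesis using g by (simp add: closed_convex_proper_def)
  qed simp
  then show ?thesis
    using r by (auto simp: subgradient_def)
qed

text \<open>Two solutions have the negated gradients of the smooth part as subgradients of \<open>g\<close>.  Their
  monotonicity contradicts the strong monotonicity of the gradient unless the solutions agree.\<close>

lemma ex1_solution:
  fixes f :: "nat \<Rightarrow> 'a::euclidean_space \<Rightarrow> real"
  assumes g: "closed_convex_proper g" and sc: "strongly_convex \<mu> (avg_fun n f)"
    and diff: "\<And>x. avg_fun n f differentiable (at x)"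
  shows "\<exists>!x. is_solution n f g x"
proof -
  define F where "F = avg_fun n f"
  have "\<mu> > 0" using sc by (simp add: strongly_convex_def)
  have "F 0 + inner (grad F 0) x + \<mu> / 2 * (norm x)\<^sup>2 \<le> F x" for x
    using strongly_convex_above_parabola[OF sc diff, of 0 x] by (simp add: F_def)
  moreover have "continuous_on UNIV F"
    unfolding F_def using diff
    by (auto intro!: continuous_at_imp_continuous_on differentiable_imp_continuous_within)
  ultimately have "\<exists>x. is_solution n f g x"
    using exists_minimiser_of_quadratic_growth[OF g _ \<open>\<mu> > 0\<close>]
    unfolding is_solution_def F_def by blast
  moreover have "x = y" if "is_solution n f g x" "is_solution n f g y" for x y
  proof -
    have sub: "subgradient g z (- grad F z)" if "is_solution n f g z" for z
      using that GDERIV_grad[OF diff] unfolding is_solution_def F_def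
      by (intro minimiser_imp_subgradient[OF g])
    have "\<mu> * (norm (x - y))\<^sup>2 \<le> inner (grad F x - grad F y) (x - y)"
      using strongly_convex_strongly_monotone[OF sc diff] by (simp add: F_def)
    also have "\<dots> \<le> 0"
      using subgradient_monotone[OF sub[OF that(1)] sub[OF that(2)]]
      by (simp add: inner_diff_left)
    finally show ?thesis
      using \<open>\<mu> > 0\<close> by (simp add: mult_le_0_iff)
  qed
  ultimately show ?thesis by blast
qed

text \<open>Dividing the objective of the proximal problem by \<open>lam\<close> leaves the minimisers unchanged and
  puts it into the form \<open>g\<close> plus a quadratic.\<close>

lemma prox_subgradient:
  fixes g :: "'a::euclidean_space \<Rightarrow> ereal"
  assumes g: "closed_convex_proper g" and "lam > 0"
  shows "subgradient g (prox lam g z) ((1 / lam) *\<^sub>R (z - prox lam g z))"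
proof -
  define q where "q = (\<lambda>x. 1 / (2 * lam) * (norm (x - z))\<^sup>2)"
  have scale: "ereal lam * g x + ereal (1 / 2 * (norm (x - z))\<^sup>2) = ereal lam * (g x + ereal (q x))"
    for x
    using \<open>lam > 0\<close> by (cases "g x") (auto simp: q_def field_simps)
  have "prox lam g z = arg_min (\<lambda>x. g x + ereal (q x)) (\<lambda>_. True)"
  proof -
    have "ereal lam * a < ereal lam * b \<longleftrightarrow> a < b" for a b :: ereal
      using \<open>lam > 0\<close> by (cases a; cases b) auto
    then show ?thesis
      unfolding prox_def arg_min_def is_arg_min_def scale by simp
  qed
  moreover have "\<exists>x. is_arg_min (\<lambda>x. g x + ereal (q x)) (\<lambda>_. True) x"
  proof (rule exists_minimiser_of_quadratic_growth[OF g])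
    show "continuous_on UNIV q"
      unfolding q_def by (intro continuous_intros)
    show "1 / (2 * lam) * (norm z)\<^sup>2 + inner (- (1 / lam) *\<^sub>R z) x + (1 / lam) / 2 * (norm x)\<^sup>2 \<le> q x"
      for x
      using \<open>lam > 0\<close> by (simp add: q_def power2_norm_eq_inner inner_commute field_simps inner_diff_left inner_diff_right)
  qed (use \<open>lam > 0\<close> in simp)
  ultimately have "is_arg_min (\<lambda>x. g x + ereal (q x)) (\<lambda>_. True) (prox lam g z)"
    unfolding arg_min_def by (metis someI_ex)
  moreover have "GDERIV q (prox lam g z) :> (1 / lam) *\<^sub>R (prox lam g z - z)"
    using \<open>lam > 0\<close> unfolding gderiv_def q_def power2_norm_eq_inner inner_scaleR_right
    by (auto intro!: derivative_eq_intros simp: fun_eq_iff inner_commute field_simps)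
  ultimately have "subgradient g (prox lam g z) (- ((1 / lam) *\<^sub>R (prox lam g z - z)))"
    by (rule minimiser_imp_subgradient[OF g])
  then show ?thesis
    by (simp add: scaleR_diff_right)
qed

text \<open>A subgradient \<open>v\<close> at \<open>xs\<close> makes \<open>xs\<close> the proximal point of \<open>xs + lam *\<^sub>R v\<close>, so this is the
  nonexpansiveness of the proximal operator, and it follows from the monotonicity of subgradients.\<close>

lemma prox_nonexpansive_at:
  fixes g :: "'a::euclidean_space \<Rightarrow> ereal"
  assumes g: "closed_convex_proper g" and "lam > 0" and "subgradient g xs v"
  shows "norm (prox lam g z - xs) \<le> norm (z - (xs + lam *\<^sub>R v))"
proof -
  define p where "p = prox lam g z"
  have "0 \<le> inner ((1 / lam) *\<^sub>R (z - p) - v) (p - xs)"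
    using subgradient_monotone[OF prox_subgradient[OF g \<open>lam > 0\<close>] assms(3)] by (simp add: p_def)
  then have "0 \<le> lam * inner ((1 / lam) *\<^sub>R (z - p) - v) (p - xs)"
    using \<open>lam > 0\<close> by simp
  also have "\<dots> = inner (z - (xs + lam *\<^sub>R v)) (p - xs) - (norm (p - xs))\<^sup>2"
    using \<open>lam > 0\<close> by (simp add: power2_norm_eq_inner algebra_simps inner_commute)
  finally have "norm (p - xs) * norm (p - xs) \<le> norm (z - (xs + lam *\<^sub>R v)) * norm (p - xs)"
    using norm_cauchy_schwarz[of "z - (xs + lam *\<^sub>R v)" "p - xs"] by (simp add: power2_eq_square)
  then show ?thesis
    by (cases "p = xs") (auto simp: p_def)
qed


section \<open>Maximal and recommended step-sizes\<close>

text \<open>As \<open>\<rho>\<close> runs from \<open>0\<close> to \<open>\<eta>\<close>, the function \<open>nu\<close> increases from \<open>4 * m - 3 * \<mu>\<close> without bound.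
  Hence the right-hand side of the equation minus \<open>\<rho>\<close> becomes negative before \<open>\<eta>\<close>, and it has a zero
  inside the interval exactly when it starts out positive.\<close>

lemma admissible_root_iff:
  fixes \<mu> \<eta> m lam :: real
  assumes "\<mu> > 0" "\<eta> > 0" "m > \<mu>" "lam > 0"
  shows "(\<exists>\<rho>. 0 < \<rho> \<and> \<rho> < \<eta> \<and> \<rho> = \<mu> * lam * (2 - nu \<mu> \<eta> m \<rho> * lam))
    \<longleftrightarrow> lam < 2 / (4 * m - 3 * \<mu>)"
proof
  assume "\<exists>\<rho>. 0 < \<rho> \<and> \<rho> < \<eta> \<and> \<rho> = \<mu> * lam * (2 - nu \<mu> \<eta> m \<rho> * lam)"
  then obtain \<rho> where \<rho>: "0 < \<rho>" "\<rho> < \<eta>" "\<rho> = \<mu> * lam * (2 - nu \<mu> \<eta> m \<rho> * lam)"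
    by blast
  have "1 \<le> sqrt (\<eta> / (\<eta> - \<rho>))"
    using \<rho>(1,2) by (simp add: field_simps)
  then have "2\<^sup>2 \<le> (1 + sqrt (\<eta> / (\<eta> - \<rho>)))\<^sup>2"
    by (intro power_mono) auto
  then have "(m - \<mu>) * 4 \<le> (m - \<mu>) * (1 + sqrt (\<eta> / (\<eta> - \<rho>)))\<^sup>2"
    using assms by (intro mult_left_mono) auto
  then have "4 * m - 3 * \<mu> \<le> nu \<mu> \<eta> m \<rho>"
    by (simp add: nu_def)
  then have "(4 * m - 3 * \<mu>) * lam \<le> nu \<mu> \<eta> m \<rho> * lam"
    using assms by (intro mult_right_mono) auto
  also have "\<dots> < 2"
  proof -
    have "0 < \<mu> * lam * (2 - nu \<mu> \<eta> m \<rho> * lam)"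
      using \<rho>(1,3) by linarith
    then have "0 < 2 - nu \<mu> \<eta> m \<rho> * lam"
      by (rule zero_less_mult_pos) (use assms in simp)
    then show ?thesis by simp
  qed
  finally show "lam < 2 / (4 * m - 3 * \<mu>)"
    using assms by (simp add: field_simps)
next
  assume "lam < 2 / (4 * m - 3 * \<mu>)"
  then have lam: "(4 * m - 3 * \<mu>) * lam < 2"
    using assms by (simp add: field_simps)
  define h where "h = (\<lambda>\<rho>. \<mu> * lam * (2 - nu \<mu> \<eta> m \<rho> * lam) - \<rho>)"
  \<comment> \<open>\<open>\<rho>1\<close> is the point where \<open>\<eta> / (\<eta> - \<rho>)\<close> equals \<open>K\<^sup>2\<close>; there \<open>nu\<close> is so large that \<open>h\<close> is negative.\<close>
  define K where "K = 1 + 2 / ((m - \<mu>) * lam)"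
  define \<rho>1 where "\<rho>1 = \<eta> - \<eta> / K\<^sup>2"
  have "1 < K" using assms by (simp add: K_def)
  then have "1 < K\<^sup>2" by (simp add: one_less_power)
  then have \<rho>1: "0 < \<rho>1" "\<rho>1 < \<eta>"
    using \<open>\<eta> > 0\<close> \<open>1 < K\<close> mult_strict_left_mono[of 1 "K\<^sup>2" \<eta>] by (auto simp: \<rho>1_def divide_less_eq)
  have "h 0 > 0"
  proof -
    have "h 0 = \<mu> * lam * (2 - (4 * m - 3 * \<mu>) * lam)"
      using \<open>\<eta> > 0\<close> by (simp add: h_def nu_def algebra_simps)
    then show ?thesis using lam assms by simp
  qed
  have "sqrt (\<eta> / (\<eta> - \<rho>1)) = K"
    using \<open>1 < K\<close> \<open>\<eta> > 0\<close> by (simp add: \<rho>1_def)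
  have "(m - \<mu>) * lam * (K - 1) = 2"
    using assms by (simp add: K_def)
  moreover have "(m - \<mu>) * lam * (K - 1) \<le> (m - \<mu>) * lam * (1 + K)\<^sup>2"
  proof (intro mult_left_mono)
    show "K - 1 \<le> (1 + K)\<^sup>2" using \<open>1 < K\<close> zero_le_power2[of K] by (simp add: power2_sum)
  qed (use assms in auto)
  ultimately have "2 \<le> (m - \<mu>) * lam * (1 + K)\<^sup>2"
    by simp
  also have "\<dots> \<le> \<mu> * lam + (m - \<mu>) * lam * (1 + K)\<^sup>2"
    using assms by simp
  also have "\<dots> = nu \<mu> \<eta> m \<rho>1 * lam"
    by (simp add: nu_def \<open>sqrt _ = K\<close> algebra_simps)
  finally have "2 \<le> nu \<mu> \<eta> m \<rho>1 * lam" .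
  then have "\<mu> * lam * (2 - nu \<mu> \<eta> m \<rho>1 * lam) \<le> 0"
    using assms by (simp add: mult_le_0_iff)
  then have "h \<rho>1 < 0"
    using \<rho>1 by (simp add: h_def)
  have "continuous_on {0..\<rho>1} h"
    unfolding h_def nu_def using \<rho>1 by (intro continuous_intros) auto
  then obtain \<rho> where \<rho>: "0 \<le> \<rho>" "\<rho> \<le> \<rho>1" "h \<rho> = 0"
    using IVT2'[of h \<rho>1 0 0] \<open>h 0 > 0\<close> \<open>h \<rho>1 < 0\<close> \<rho>1 by auto
  moreover have "\<rho> \<noteq> 0" using \<rho> \<open>h 0 > 0\<close> by auto
  ultimately show "\<exists>\<rho>. 0 < \<rho> \<and> \<rho> < \<eta> \<and> \<rho> = \<mu> * lam * (2 - nu \<mu> \<eta> m \<rho> * lam)"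
    using \<rho>1 by (intro exI[of _ \<rho>]) (auto simp: h_def)
qed

lemma SUP_ereal_Ioo:
  fixes c :: real
  assumes "0 < c"
  shows "(SUP x\<in>{0<..<c}. ereal x) = ereal c"
proof (rule SUP_eqI)
  fix y assume y: "\<And>x. x \<in> {0<..<c} \<Longrightarrow> ereal x \<le> y"
  show "ereal c \<le> y"
  proof (cases y)
    case (real r)
    have "c \<le> r"
    proof (rule dense_le_bounded[of 0])
      show "x \<le> r" if "0 < x" "x < c" for x
        using y[of x] that real by simp
    qed fact
    then show ?thesis using real by simp
  next
    case MInf
    then show ?thesis using y[of "c / 2"] assms by simp
  qed simp
qed auto

lemma max_step_eq:
  assumes "\<mu> > 0" "\<eta> > 0" and m: "weighted_max n L p = m" "\<mu> \<le> m"
  shows "max_step n L p \<mu> \<eta> = ereal (2 / (4 * m - 3 * \<mu>))"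
proof -
  have "{lam. admissible_step n L p \<mu> \<eta> lam} = {0<..<2 / (4 * m - 3 * \<mu>)}"
  proof (cases "m = \<mu>")
    case True
    have "\<mu> * lam * (2 - \<mu> * lam) \<le> 1" for lam
      using zero_le_power2[of "\<mu> * lam - 1"] by (simp add: power2_eq_square algebra_simps)
    moreover have "0 < \<mu> * lam * (2 - \<mu> * lam) \<longleftrightarrow> lam < 2 / \<mu>" if "0 < lam" for lam
      using that \<open>\<mu> > 0\<close> by (simp add: zero_less_mult_iff field_simps not_less)
    ultimately show ?thesis
      using True m by (auto simp: admissible_step_def)
  next
    case False
    then have "\<mu> < m" using m(2) by simp
    have "admissible_step n L p \<mu> \<eta> lam \<longleftrightarrow> 0 < lam \<and> lam < 2 / (4 * m - 3 * \<mu>)" for lam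
    proof -
      have "admissible_step n L p \<mu> \<eta> lam \<longleftrightarrow>
          0 < lam \<and> (\<exists>\<rho>. 0 < \<rho> \<and> \<rho> < \<eta> \<and> \<rho> = \<mu> * lam * (2 - nu \<mu> \<eta> m \<rho> * lam))"
        by (simp only: admissible_step_def m(1) \<open>\<mu> < m\<close> False simp_thms)
      then show ?thesis
        using admissible_root_iff[OF assms(1,2) \<open>\<mu> < m\<close>] by blast
    qed
    then show ?thesis
      unfolding set_eq_iff mem_Collect_eq greaterThanLessThan_iff by (rule allI)
  qed
  moreover have "0 < 2 / (4 * m - 3 * \<mu>)"
    using assms by simp
  ultimately show ?thesis
    by (simp add: max_step_def SUP_ereal_Ioo)
qed

text \<open>Put \<open>a = 4 * m - 3 * \<mu>\<close> and \<open>s = \<mu> * lam / \<eta>\<close>.  The formula for \<open>lam\<close> is the smaller root of a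
  quadratic that can be written as \<open>lam * a * (2 - s) = 2 * (1 - s)\<close>.  In terms of the square root
  \<open>r\<close> with \<open>r\<^sup>2 = 1 / (1 - s)\<close>, which occurs in \<open>nu\<close> at \<open>\<rho> = \<mu> * lam\<close>, it reads
  \<open>lam * a * (r\<^sup>2 + 1) = 2\<close>.  Together with \<open>1 \<le> r\<^sup>2\<close> and \<open>(1 + r)\<^sup>2 \<le> 2 * (r\<^sup>2 + 1)\<close> this bounds
  \<open>nu * lam\<close> by \<open>1\<close>.\<close>

lemma recommended_step:
  fixes \<mu> \<eta> m lam :: real
  assumes "\<mu> > 0" "\<eta> > 0" "\<mu> \<le> m"
    and lam: "lam = 2 / ((4 * m - 3 * \<mu>) + \<mu> / \<eta> + sqrt ((4 * m - 3 * \<mu>)\<^sup>2 + (\<mu> / \<eta>)\<^sup>2))"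
  shows "0 < lam" and "\<mu> * lam < \<eta>" and "nu \<mu> \<eta> m (\<mu> * lam) * lam \<le> 1"
proof -
  define a where "a = 4 * m - 3 * \<mu>"
  define b where "b = \<mu> / \<eta>"
  define q where "q = sqrt (a\<^sup>2 + b\<^sup>2)"
  have "a > 0" "b > 0" using assms by (auto simp: a_def b_def)
  have lam: "lam = 2 / (a + b + q)"
    using lam by (simp add: a_def b_def q_def)
  have "q > b"
    unfolding q_def using \<open>a > 0\<close> \<open>b > 0\<close> by (intro real_less_rsqrt) simp
  show "0 < lam"
    using \<open>a > 0\<close> \<open>b > 0\<close> \<open>q > b\<close> by (simp add: lam)
  define s where "s = b * lam"
  have "s > 0" using \<open>0 < lam\<close> \<open>b > 0\<close> by (simp add: s_def)
  have "s < 1"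
    using \<open>a > 0\<close> \<open>b > 0\<close> \<open>q > b\<close> by (simp add: s_def lam field_simps)
  then show "\<mu> * lam < \<eta>"
    using \<open>\<eta> > 0\<close> by (simp add: s_def b_def field_simps)
  have q2: "q\<^sup>2 = a\<^sup>2 + b\<^sup>2" by (simp add: q_def)
  have cancel: "2 / D * D = 2" if "D > 0" for D :: real
    using that by simp
  have "lam * (a + b + q) = 2"
    unfolding lam using \<open>a > 0\<close> \<open>b > 0\<close> \<open>q > b\<close> by (intro cancel) simp
  then have lq: "lam * q = 2 - lam * a - s"
    by (simp add: s_def algebra_simps)
  have "lam\<^sup>2 * (a\<^sup>2 + b\<^sup>2) = (2 - lam * a - s)\<^sup>2"
    unfolding q2[symmetric] lq[symmetric] by (rule power_mult_distrib[symmetric])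
  then have "lam * a * (2 - s) = 2 * (1 - s)"
    by (simp add: s_def power2_eq_square algebra_simps)
  define r where "r = sqrt (\<eta> / (\<eta> - \<mu> * lam))"
  have "\<eta> - \<mu> * lam = \<eta> * (1 - s)"
    using \<open>\<eta> > 0\<close> by (simp add: s_def b_def field_simps)
  then have "r\<^sup>2 = 1 / (1 - s)"
    using \<open>s < 1\<close> \<open>\<eta> > 0\<close> by (simp add: r_def)
  then have "1 \<le> r\<^sup>2" and "(r\<^sup>2 + 1) * (1 - s) = 2 - s"
    using \<open>s > 0\<close> \<open>s < 1\<close> by (simp_all add: distrib_right)
  then have "lam * a * (r\<^sup>2 + 1) * (1 - s) = 2 * (1 - s)"
    using \<open>lam * a * (2 - s) = 2 * (1 - s)\<close> by (simp add: mult.assoc)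
  then have r: "lam * a * (r\<^sup>2 + 1) = 2"
    using \<open>s < 1\<close> by (simp only: mult_right_cancel)
  have "2 * (1 + r)\<^sup>2 \<le> 4 * (r\<^sup>2 + 1)"
    using zero_le_power2[of "r - 1"] by (simp add: power2_eq_square algebra_simps)
  then have "(m - \<mu>) * (2 * (1 + r)\<^sup>2) \<le> (m - \<mu>) * (4 * (r\<^sup>2 + 1))"
    using assms by (intro mult_left_mono) auto
  moreover have "\<mu> * 2 \<le> \<mu> * (r\<^sup>2 + 1)"
    using assms \<open>1 \<le> r\<^sup>2\<close> by (intro mult_left_mono) auto
  ultimately have "2 * nu \<mu> \<eta> m (\<mu> * lam) \<le> a * (r\<^sup>2 + 1)"
    by (simp add: nu_def r_def[symmetric] a_def algebra_simps)
  then have "lam * (2 * nu \<mu> \<eta> m (\<mu> * lam)) \<le> lam * (a * (r\<^sup>2 + 1))"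
    using \<open>0 < lam\<close> by (intro mult_left_mono) auto
  then show "nu \<mu> \<eta> m (\<mu> * lam) * lam \<le> 1"
    using r by (simp add: mult_ac)
qed


section \<open>Variance reduction in one step\<close>

definition wmean :: "('i \<Rightarrow> real) \<Rightarrow> 'i set \<Rightarrow> ('i \<Rightarrow> 'a::real_inner) \<Rightarrow> 'a" where
  "wmean p S u = (\<Sum>i\<in>S. p i *\<^sub>R u i)"

definition wvar :: "('i \<Rightarrow> real) \<Rightarrow> 'i set \<Rightarrow> ('i \<Rightarrow> 'a::real_inner) \<Rightarrow> real" where
  "wvar p S u = (\<Sum>i\<in>S. p i * (norm (u i - wmean p S u))\<^sup>2)"

lemma wvar_nonneg: "(\<And>i. i \<in> S \<Longrightarrow> 0 \<le> p i) \<Longrightarrow> 0 \<le> wvar p S u"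
  unfolding wvar_def by (intro sum_nonneg) auto

lemma second_moment_eq:
  assumes "sum p S = 1"
  shows "(\<Sum>i\<in>S. p i * (norm (u i))\<^sup>2) = wvar p S u + (norm (wmean p S u))\<^sup>2"
proof -
  define w where "w = wmean p S u"
  have "wvar p S u = (\<Sum>i\<in>S. p i * (norm (u i))\<^sup>2 - 2 * inner (p i *\<^sub>R u i) w + p i * (norm w)\<^sup>2)"
    unfolding wvar_def w_def[symmetric]
    by (intro sum.cong) (auto simp: power2_norm_eq_inner algebra_simps inner_commute)
  also have "\<dots> = (\<Sum>i\<in>S. p i * (norm (u i))\<^sup>2) - 2 * (\<Sum>i\<in>S. inner (p i *\<^sub>R u i) w)
      + sum p S * (norm w)\<^sup>2"
    unfolding sum.distrib sum_subtractf sum_distrib_left sum_distrib_right ..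
  also have "(\<Sum>i\<in>S. inner (p i *\<^sub>R u i) w) = inner w w"
    by (subst inner_sum_left[symmetric]) (simp add: w_def wmean_def)
  finally show ?thesis
    by (simp add: assms w_def power2_norm_eq_inner)
qed

text \<open>The defect is the square \<open>(norm (r *\<^sub>R u + v))\<^sup>2 / r\<close>.\<close>

lemma norm_diff_squared_le:
  fixes u v :: "'a::real_inner"
  assumes "r > 0"
  shows "(norm (u - v))\<^sup>2 \<le> (1 + r) * (norm u)\<^sup>2 + (1 + 1 / r) * (norm v)\<^sup>2"
proof -
  have "0 \<le> 1 / r * (norm (r *\<^sub>R u + v))\<^sup>2"
    using assms by simp
  also have "\<dots> = (1 + r) * (norm u)\<^sup>2 + (1 + 1 / r) * (norm v)\<^sup>2 - (norm (u - v))\<^sup>2"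
    using assms by (simp add: power2_norm_eq_inner inner_commute field_simps inner_add_left inner_add_right inner_diff_left inner_diff_right)
  finally show ?thesis by simp
qed

lemma wvar_diff_le:
  assumes "r > 0" and "\<And>i. i \<in> S \<Longrightarrow> 0 \<le> p i"
  shows "wvar p S (\<lambda>i. a i - b i) \<le> (1 + r) * wvar p S a + (1 + 1 / r) * wvar p S b"
proof -
  have "wmean p S (\<lambda>i. a i - b i) = wmean p S a - wmean p S b"
    by (simp add: wmean_def scaleR_diff_right sum_subtractf)
  then have "a i - b i - wmean p S (\<lambda>i. a i - b i) = (a i - wmean p S a) - (b i - wmean p S b)" for i
    by simp
  then have "wvar p S (\<lambda>i. a i - b i)
      = (\<Sum>i\<in>S. p i * (norm ((a i - wmean p S a) - (b i - wmean p S b)))\<^sup>2)"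
    unfolding wvar_def by (simp only:)
  also have "\<dots> \<le> (\<Sum>i\<in>S. p i * ((1 + r) * (norm (a i - wmean p S a))\<^sup>2
      + (1 + 1 / r) * (norm (b i - wmean p S b))\<^sup>2))"
    using assms by (intro sum_mono mult_left_mono norm_diff_squared_le) auto
  also have "\<dots> = (1 + r) * wvar p S a + (1 + 1 / r) * wvar p S b"
    by (simp add: wvar_def distrib_left sum.distrib sum_distrib_left mult.left_commute)
  finally show ?thesis .
qed

text \<open>One step in expectation, before the proximal operator.  Here \<open>d\<close> is the error of the iterate,
  \<open>a i\<close> and \<open>b i\<close> are the importance-weighted errors of the current gradients and of the dual points,
  and \<open>d - lam *\<^sub>R (a i - b i + wmean p S b)\<close> is the error after a gradient step with sample \<open>i\<close>.
  The second moment of that error splits into its squared mean and \<open>lam\<^sup>2\<close> times the variance of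
  \<open>a - b\<close>, which is at most \<open>(1 + r)\<close> times that of \<open>a\<close> plus \<open>(1 + 1 / r)\<close> times that of \<open>b\<close>.  The constant
  \<open>c\<close> makes the dual terms on both sides balance; \<open>r\<close> minimises the resulting coefficient of the
  variance of \<open>a\<close>, which becomes \<open>lam\<^sup>2 * (1 + r)\<^sup>2\<close>.  Since that variance is a second moment minus the
  squared mean, cocoercivity and strong monotonicity bound the second-order primal terms by
  \<open>lam\<^sup>2 * nu \<mu> \<eta> m (\<mu> * lam) * T\<close>.\<close>

lemma svrg_step_inequality:
  fixes a b :: "'i \<Rightarrow> 'a::real_inner" and d :: 'a
  assumes p: "\<And>i. i \<in> S \<Longrightarrow> 0 \<le> p i" "sum p S = 1"
    and "\<mu> > 0" "lam > 0" "\<eta> > 0" "\<mu> * lam < \<eta>"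
    and nu: "nu \<mu> \<eta> m (\<mu> * lam) * lam \<le> 1"
    and T: "T = inner (wmean p S a) d"
    and cocoercive: "(\<Sum>i\<in>S. p i * (norm (a i))\<^sup>2) \<le> m * T"
    and strong: "\<mu> * (norm d)\<^sup>2 \<le> T"
    and r: "r = sqrt (\<eta> / (\<eta> - \<mu> * lam))"
    and c: "c = lam\<^sup>2 * (1 + 1 / r) / (\<eta> - \<mu> * lam)"
  shows "(\<Sum>i\<in>S. p i * (norm (d - lam *\<^sub>R (a i - b i + wmean p S b)))\<^sup>2)
      + c * (\<eta> * wvar p S a + (1 - \<eta>) * wvar p S b)
    \<le> (1 - \<mu> * lam) * ((norm d)\<^sup>2 + c * wvar p S b)"
proof -
  define G where "G = wmean p S a"
  define u where "u = (\<lambda>i. d - lam *\<^sub>R (a i - b i + wmean p S b))"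
  have "r > 0"
    using \<open>\<mu> * lam < \<eta>\<close> \<open>\<eta> > 0\<close> by (simp add: r)
  have diff_mean: "wmean p S (\<lambda>i. a i - b i) = G - wmean p S b"
    by (simp add: wmean_def G_def scaleR_diff_right sum_subtractf)
  have mean: "wmean p S u = d - lam *\<^sub>R G"
  proof -
    have "wmean p S (\<lambda>i. d - lam *\<^sub>R (a i - b i + w))
        = sum p S *\<^sub>R d - lam *\<^sub>R (wmean p S (\<lambda>i. a i - b i) + sum p S *\<^sub>R w)" for w
      by (simp add: wmean_def scaleR_diff_right scaleR_add_right sum.distrib sum_subtractf
          scaleR_sum_left scaleR_sum_right mult.commute[of lam])
    then have "wmean p S u
        = sum p S *\<^sub>R d - lam *\<^sub>R (wmean p S (\<lambda>i. a i - b i) + sum p S *\<^sub>R wmean p S b)"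
      unfolding u_def .
    then show ?thesis
      by (simp add: diff_mean p)
  qed
  have "u i - wmean p S u = - lam *\<^sub>R (a i - b i - wmean p S (\<lambda>i. a i - b i))" for i
    unfolding mean diff_mean by (simp add: u_def algebra_simps)
  then have "wvar p S u = lam\<^sup>2 * wvar p S (\<lambda>i. a i - b i)"
    unfolding wvar_def
    by (simp add: power_mult_distrib sum_distrib_left mult.left_commute)
  also have "\<dots> \<le> lam\<^sup>2 * ((1 + r) * wvar p S a + (1 + 1 / r) * wvar p S b)"
    using wvar_diff_le[OF \<open>r > 0\<close> p(1)] by (intro mult_left_mono) auto
  finally have var_u: "wvar p S u \<le> lam\<^sup>2 * ((1 + r) * wvar p S a + (1 + 1 / r) * wvar p S b)" .
  have mean_u: "(norm (wmean p S u))\<^sup>2 = (norm d)\<^sup>2 - 2 * lam * T + lam\<^sup>2 * (norm G)\<^sup>2"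
    unfolding mean T G_def[symmetric] power2_norm_eq_inner
    by (simp add: power2_eq_square algebra_simps inner_commute)
  have "0 \<le> \<mu> * (norm d)\<^sup>2" using \<open>\<mu> > 0\<close> by simp
  then have "T \<ge> 0" using strong by linarith
  have "\<mu> * T \<le> (norm G)\<^sup>2"
    using strongly_monotone_grad_norm[OF \<open>\<mu> > 0\<close>, of d G] strong by (simp add: T G_def)
  have "wvar p S a \<le> m * T - (norm G)\<^sup>2"
    using cocoercive second_moment_eq[OF p(2), of a] by (simp add: G_def)
  \<comment> \<open>The dual part of \<open>c\<close> is exactly absorbed, and its primal part completes the square
     \<open>(1 + r)\<^sup>2\<close> because \<open>\<eta> / (\<eta> - \<mu> lam) = r\<^sup>2\<close>.\<close>
  have c1: "c * (\<eta> - \<mu> * lam) = lam\<^sup>2 * (1 + 1 / r)"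
    using \<open>\<mu> * lam < \<eta>\<close> by (simp add: c)
  have "r\<^sup>2 = \<eta> / (\<eta> - \<mu> * lam)"
    using \<open>\<mu> * lam < \<eta>\<close> \<open>\<eta> > 0\<close> by (simp add: r)
  then have "c * \<eta> = lam\<^sup>2 * (1 + 1 / r) * r\<^sup>2"
    by (simp add: c)
  also have "\<dots> = lam\<^sup>2 * (r\<^sup>2 + r)"
    using \<open>r > 0\<close> by (simp add: field_simps power2_eq_square)
  finally have c2: "c * \<eta> = lam\<^sup>2 * (r\<^sup>2 + r)" .
  have "(norm G)\<^sup>2 + (1 + r)\<^sup>2 * wvar p S a \<le> nu \<mu> \<eta> m (\<mu> * lam) * T"
  proof -
    have "1 \<le> (1 + r)\<^sup>2" using \<open>r > 0\<close> by simp
    then have "((1 + r)\<^sup>2 - 1) * (\<mu> * T) \<le> ((1 + r)\<^sup>2 - 1) * (norm G)\<^sup>2"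
      using \<open>\<mu> * T \<le> (norm G)\<^sup>2\<close> by (intro mult_left_mono) auto
    moreover have "(1 + r)\<^sup>2 * wvar p S a \<le> (1 + r)\<^sup>2 * (m * T - (norm G)\<^sup>2)"
      using \<open>wvar p S a \<le> m * T - (norm G)\<^sup>2\<close> by (intro mult_left_mono) auto
    moreover have nu_eq: "nu \<mu> \<eta> m (\<mu> * lam) = \<mu> + (m - \<mu>) * (1 + r)\<^sup>2"
      by (simp add: nu_def r)
    ultimately show ?thesis
      unfolding nu_eq
      by (simp add: algebra_simps)
  qed
  then have "lam * (lam * ((norm G)\<^sup>2 + (1 + r)\<^sup>2 * wvar p S a)) \<le> lam * (lam * (nu \<mu> \<eta> m (\<mu> * lam) * T))"
    using \<open>lam > 0\<close> by (intro mult_left_mono) auto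
  also have "\<dots> = lam * ((nu \<mu> \<eta> m (\<mu> * lam) * lam) * T)"
    by (simp add: mult_ac)
  also have "\<dots> \<le> lam * (1 * T)"
    using nu \<open>T \<ge> 0\<close> \<open>lam > 0\<close> by (intro mult_left_mono mult_right_mono) auto
  finally have nuT: "lam\<^sup>2 * (norm G)\<^sup>2 + lam\<^sup>2 * (1 + r)\<^sup>2 * wvar p S a \<le> lam * T"
    by (simp add: power2_eq_square algebra_simps)
  have muT: "lam * (\<mu> * (norm d)\<^sup>2) \<le> lam * T"
    using strong \<open>lam > 0\<close> by (intro mult_left_mono) auto
  have "(\<Sum>i\<in>S. p i * (norm (u i))\<^sup>2) + c * (\<eta> * wvar p S a + (1 - \<eta>) * wvar p S b)
      = wvar p S u + (norm (wmean p S u))\<^sup>2 + c * \<eta> * wvar p S a + c * (1 - \<eta>) * wvar p S b"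
    using second_moment_eq[OF p(2), of u] by (simp add: algebra_simps)
  also have "\<dots> \<le> (norm d)\<^sup>2 - 2 * lam * T + lam\<^sup>2 * (norm G)\<^sup>2 + lam\<^sup>2 * (1 + r)\<^sup>2 * wvar p S a
      + (c * (\<eta> - \<mu> * lam) + c * (1 - \<eta>)) * wvar p S b"
    using var_u unfolding mean_u c1 c2 by (simp add: algebra_simps power2_eq_square)
  also have "\<dots> \<le> (norm d)\<^sup>2 - lam * (\<mu> * (norm d)\<^sup>2) + (c * (\<eta> - \<mu> * lam) + c * (1 - \<eta>)) * wvar p S b"
    using nuT muT by linarith
  also have "\<dots> = (1 - \<mu> * lam) * ((norm d)\<^sup>2 + c * wvar p S b)"
    by (simp add: algebra_simps)
  finally show ?thesis
    by (simp add: u_def)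
qed

text \<open>Importance weighting multiplies the \<open>i\<close>-th squared gradient difference by \<open>1 / (n\<^sup>2 * p i)\<close>;
  cocoercivity of \<open>f i\<close> costs a factor \<open>L i\<close>, which leaves \<open>L i / (n * p i)\<close> in front of the share of
  \<open>f i\<close> in the averaged inner product.\<close>

lemma weighted_cocoercivity:
  fixes f :: "nat \<Rightarrow> 'a::euclidean_space \<Rightarrow> real"
  assumes "n \<ge> 1" and p: "\<And>i. i \<in> {1..n} \<Longrightarrow> p i > 0"
    and smooth: "\<And>i. i \<in> {1..n} \<Longrightarrow> smooth_fun (L i) (f i)"
  shows "(\<Sum>i\<in>{1..n}. p i * (norm ((1 / (real n * p i)) *\<^sub>R (grad (f i) x - grad (f i) y)))\<^sup>2)
    \<le> weighted_max n L p * inner (grad (avg_fun n f) x - grad (avg_fun n f) y) (x - y)"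
proof -
  define A where "A = (\<lambda>i. grad (f i) x - grad (f i) y)"
  have "p i * (norm ((1 / (real n * p i)) *\<^sub>R A i))\<^sup>2
      \<le> weighted_max n L p * (1 / real n * inner (A i) (x - y))" if i: "i \<in> {1..n}" for i
  proof -
    have "L i > 0" and co: "1 / L i * (norm (A i))\<^sup>2 \<le> inner (A i) (x - y)"
      using smooth[OF i] by (auto simp: smooth_fun_def A_def)
    have "0 \<le> 1 / L i * (norm (A i))\<^sup>2" using \<open>L i > 0\<close> by simp
    then have "0 \<le> inner (A i) (x - y)" using co by linarith
    have "p i * (norm ((1 / (real n * p i)) *\<^sub>R A i))\<^sup>2
        = L i / (real n * p i) * (1 / real n * (1 / L i * (norm (A i))\<^sup>2))"
      using p[OF i] \<open>L i > 0\<close> \<open>n \<ge> 1\<close> by (simp add: power_mult_distrib power2_eq_square field_simps)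
    also have "\<dots> \<le> L i / (real n * p i) * (1 / real n * inner (A i) (x - y))"
      using co p[OF i] \<open>L i > 0\<close> by (intro mult_left_mono) auto
    also have "\<dots> \<le> weighted_max n L p * (1 / real n * inner (A i) (x - y))"
      using \<open>0 \<le> inner (A i) (x - y)\<close> i unfolding weighted_max_def
      by (intro mult_right_mono Max_ge) auto
    finally show ?thesis .
  qed
  then have "(\<Sum>i\<in>{1..n}. p i * (norm ((1 / (real n * p i)) *\<^sub>R A i))\<^sup>2)
      \<le> (\<Sum>i\<in>{1..n}. weighted_max n L p * (1 / real n * inner (A i) (x - y)))"
    by (rule sum_mono)
  also have "\<dots> = weighted_max n L p * inner ((1 / real n) *\<^sub>R (\<Sum>i\<in>{1..n}. A i)) (x - y)"
    by (simp add: inner_sum_left sum_distrib_left)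
  also have "(1 / real n) *\<^sub>R (\<Sum>i\<in>{1..n}. A i) = grad (avg_fun n f) x - grad (avg_fun n f) y"
  proof -
    have "f i differentiable (at z)" if "i \<in> {1..n}" for i z
      using smooth[OF that] by (simp add: smooth_fun_def)
    then have "grad (avg_fun n f) z = (1 / real n) *\<^sub>R (\<Sum>i\<in>{1..n}. grad (f i) z)" for z
      by (rule grad_avg_fun)
    then show ?thesis
      by (simp add: A_def sum_subtractf scaleR_diff_right)
  qed
  finally show ?thesis
    by (simp add: A_def)
qed


section \<open>Independence of the fresh sample\<close>

text \<open>The numbers \<open>Q j\<close> enter the algorithm only through the comparison with \<open>\<eta>\<close>.  Recording just its
  outcome makes the history finitely valued, so that every real function of the state is a
  bounded random variable.\<close>

definition sample_history :: "(nat \<Rightarrow> 'w \<Rightarrow> nat) \<Rightarrow> (nat \<Rightarrow> 'w \<Rightarrow> real) \<Rightarrow> real \<Rightarrow> nat \<Rightarrow> 'w \<Rightarrow> (nat \<times> bool) list" where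
  "sample_history I Q \<eta> k \<omega> = map (\<lambda>j. (I j \<omega>, Q j \<omega> < \<eta>)) [0..<k]"

lemma lsvrg_cong:
  assumes "\<And>j. j < k \<Longrightarrow> i j = i' j" and "\<And>j. j < k \<Longrightarrow> q j < \<eta> \<longleftrightarrow> q' j < \<eta>"
  shows "lsvrg n f g p lam \<eta> x0 xhat i q k = lsvrg n f g p lam \<eta> x0 xhat i' q' k"
  using assms
proof (induction k)
  case (Suc k)
  then have "lsvrg n f g p lam \<eta> x0 xhat i q k = lsvrg n f g p lam \<eta> x0 xhat i' q' k"
    by simp
  then show ?case
    using Suc.prems by simp
qed simp

text \<open>The values \<open>\<eta> - 1\<close> and \<open>\<eta>\<close> are arbitrary representatives of the two outcomes of the comparison.\<close>

lemma lsvrg_factors_through_sample_history: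
  "\<exists>h. \<forall>\<omega>. lsvrg n f g p lam \<eta> x0 xhat (\<lambda>j. I j \<omega>) (\<lambda>j. Q j \<omega>) k = h (sample_history I Q \<eta> k \<omega>)"
proof (intro exI allI)
  show "lsvrg n f g p lam \<eta> x0 xhat (\<lambda>j. I j \<omega>) (\<lambda>j. Q j \<omega>) k
    = (\<lambda>zs. lsvrg n f g p lam \<eta> x0 xhat (\<lambda>j. fst (zs ! j))
        (\<lambda>j. if snd (zs ! j) then \<eta> - 1 else \<eta>) k) (sample_history I Q \<eta> k \<omega>)" for \<omega>
    by (auto simp: sample_history_def split: if_splits intro!: lsvrg_cong)
qed

lemma measurable_discretised_prefix:
  "(\<lambda>v. map (\<lambda>j. (fst (v j), snd (v j) < (\<eta>::real))) [0..<k])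
    \<in> measurable (\<Pi>\<^sub>M j\<in>{..<k}. count_space {1..n::nat} \<Otimes>\<^sub>M borel) (count_space UNIV)"
  (is "?m \<in> measurable ?P _")
proof -
  have comp: "(\<lambda>v. v j) \<in> measurable ?P (count_space {1..n} \<Otimes>\<^sub>M borel)" if "j < k" for j
    using that by (intro measurable_component_singleton) simp
  have pred: "Measurable.pred ?P (\<lambda>v. fst (v j) = a \<and> (snd (v j) < \<eta>) = b)" if "j < k" for j a b
  proof -
    have "(\<lambda>x. x = a) \<in> measurable (count_space {1..n}) (count_space UNIV)"
      by simp
    then have 1: "Measurable.pred ?P (\<lambda>v. fst (v j) = a)"
      by (rule measurable_compose[rotated]) (rule measurable_compose[OF comp[OF that] measurable_fst])
    have "(\<lambda>v. snd (v j)) \<in> borel_measurable ?P"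
      by (rule measurable_compose[OF comp[OF that] measurable_snd])
    then have 2: "Measurable.pred ?P (\<lambda>v. snd (v j) < \<eta>)"
      by (intro borel_measurable_pred_less borel_measurable_const)
    have 3: "Measurable.pred ?P (\<lambda>v. b)"
      by (rule measurable_const) simp
    show ?thesis
      by (rule pred_intros_logic(3)[OF 1 pred_intros_logic(6)[OF 2 3]])
  qed
  have "?m -` {zs} \<inter> space ?P \<in> sets ?P" for zs
  proof (cases "length zs = k")
    case True
    have iff: "map (\<lambda>j. (fst (v j), snd (v j) < \<eta>)) [0..<k] = zs \<longleftrightarrow>
        (\<forall>j\<in>{..<k}. fst (v j) = fst (zs ! j) \<and> (snd (v j) < \<eta>) = snd (zs ! j))"
      for v :: "nat \<Rightarrow> nat \<times> real"
      unfolding list_eq_iff_nth_eq prod_eq_iff using True by (simp add: Ball_def)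
    have "?m -` {zs} \<inter> space ?P = {v \<in> space ?P. ?m v = zs}"
      by blast
    also have "\<dots> = {v \<in> space ?P. \<forall>j\<in>{..<k}. fst (v j) = fst (zs ! j) \<and> (snd (v j) < \<eta>) = snd (zs ! j)}"
      by (simp only: iff)
    also have "\<dots> \<in> sets ?P"
      using pred by (intro sets.sets_Collect_finite_All) (auto simp: pred_def)
    finally show ?thesis .
  next
    case False
    then have "?m -` {zs} \<inter> space ?P = {}" by auto
    then show ?thesis by simp
  qed
  then show ?thesis
    by (simp add: measurable_count_space_eq2_countable)
qed

text \<open>The history before step \<open>k\<close> is a function of the samples with index below \<open>k\<close> and hence
  independent of the sample used in step \<open>k\<close>.\<close>

lemma
  fixes h :: "(nat \<times> bool) list \<Rightarrow> real"
  assumes samp: "lsvrg_sampling M n p I Q"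
  shows integrable_sample_history: "integrable M (\<lambda>\<omega>. h (sample_history I Q \<eta> k \<omega>))"
    and fresh_sample_integrable: "B \<in> sets (count_space {1..n} \<Otimes>\<^sub>M borel) \<Longrightarrow>
      integrable M (\<lambda>\<omega>. indicator B (I k \<omega>, Q k \<omega>) * h (sample_history I Q \<eta> k \<omega>))"
    and fresh_sample_integral: "B \<in> sets (count_space {1..n} \<Otimes>\<^sub>M borel) \<Longrightarrow>
      (\<integral>\<omega>. indicator B (I k \<omega>, Q k \<omega>) * h (sample_history I Q \<eta> k \<omega>) \<partial>M)
        = measure M {\<omega> \<in> space M. (I k \<omega>, Q k \<omega>) \<in> B} * (\<integral>\<omega>. h (sample_history I Q \<eta> k \<omega>) \<partial>M)"
proof -
  interpret prob_space M
    using samp by (simp add: lsvrg_sampling_def)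
  define N where "N = count_space {1..n} \<Otimes>\<^sub>M (borel :: real measure)"
  define Z where "Z = (\<lambda>j \<omega>. (I j \<omega>, Q j \<omega>))"
  have indep: "indep_vars (\<lambda>_. N) Z UNIV"
    using samp by (simp add: lsvrg_sampling_def N_def Z_def)
  then have Z: "Z j \<in> measurable M N" for j
    by (simp add: indep_vars_def)
  define Y1 where "Y1 = (\<lambda>v. h (map (\<lambda>j. (fst (v j), snd (v j) < \<eta>)) [0..<k]))"
  have Y1: "Y1 \<in> borel_measurable (PiM {..<k} (\<lambda>_. N))"
    unfolding Y1_def N_def by (rule measurable_compose[OF measurable_discretised_prefix]) simp
  have Y1_sample_history: "Y1 \<circ> (\<lambda>\<omega>. restrict (\<lambda>j. Z j \<omega>) {..<k}) = (\<lambda>\<omega>. h (sample_history I Q \<eta> k \<omega>))"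
    by (auto simp: Y1_def Z_def sample_history_def fun_eq_iff intro!: arg_cong[where f = h])
  have past: "(\<lambda>\<omega>. restrict (\<lambda>j. Z j \<omega>) {..<k}) \<in> measurable M (PiM {..<k} (\<lambda>_. N))"
    using Z by (intro measurable_restrict)
  define S where "S = {zs. set zs \<subseteq> {1..n} \<times> (UNIV :: bool set) \<and> length zs = k}"
  have "finite S"
    unfolding S_def by (intro finite_lists_length_eq) auto
  have "\<bar>h (sample_history I Q \<eta> k \<omega>)\<bar> \<le> (\<Sum>zs\<in>S. \<bar>h zs\<bar>)" if "\<omega> \<in> space M" for \<omega>
  proof -
    have "I j \<omega> \<in> {1..n}" for j
      using measurable_space[OF Z that, of j] by (simp add: Z_def N_def space_pair_measure)
    then have "sample_history I Q \<eta> k \<omega> \<in> S"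
      by (auto simp: S_def sample_history_def)
    then show ?thesis
      using \<open>finite S\<close> by (intro member_le_sum) auto
  qed
  moreover have "(\<lambda>\<omega>. h (sample_history I Q \<eta> k \<omega>)) \<in> borel_measurable M"
    using measurable_comp[OF past Y1] unfolding Y1_sample_history .
  ultimately show int1: "integrable M (\<lambda>\<omega>. h (sample_history I Q \<eta> k \<omega>))"
    by (intro integrable_const_bound[of _ "\<Sum>zs\<in>S. \<bar>h zs\<bar>"]) auto
  assume B: "B \<in> sets (count_space {1..n} \<Otimes>\<^sub>M borel)"
  define Y2 where "Y2 = (\<lambda>v :: nat \<Rightarrow> nat \<times> real. indicator B (v k) :: real)"
  have Y2: "Y2 \<in> borel_measurable (PiM {k} (\<lambda>_. N))"
    unfolding Y2_def
    using B unfolding N_def[symmetric]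
    by (intro measurable_compose[OF measurable_component_singleton borel_measurable_indicator]) auto
  have Y2_now: "Y2 \<circ> (\<lambda>\<omega>. restrict (\<lambda>j. Z j \<omega>) {k}) = (\<lambda>\<omega>. indicator B (Z k \<omega>))"
    by (auto simp: Y2_def)
  have "indep_var (PiM {k} (\<lambda>_. N)) (\<lambda>\<omega>. restrict (\<lambda>j. Z j \<omega>) {k})
      (PiM {..<k} (\<lambda>_. N)) (\<lambda>\<omega>. restrict (\<lambda>j. Z j \<omega>) {..<k})"
    using indep by (rule indep_var_restrict) auto
  from indep_var_compose[OF this Y2 Y1]
  have ind: "indep_var borel (\<lambda>\<omega>. indicator B (Z k \<omega>)) borel (\<lambda>\<omega>. h (sample_history I Q \<eta> k \<omega>))"
    unfolding Y1_sample_history Y2_now .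
  define A where "A = {\<omega> \<in> space M. (I k \<omega>, Q k \<omega>) \<in> B}"
  have "A = Z k -` B \<inter> space M"
    by (auto simp: A_def Z_def)
  then have A: "A \<in> sets M"
    using measurable_sets[OF Z B[folded N_def]] by (simp only:)
  have int2: "integrable M (\<lambda>\<omega>. indicator B (Z k \<omega>) :: real)"
    and eq2: "(\<integral>\<omega>. (indicator B (Z k \<omega>) :: real) \<partial>M) = measure M A"
  proof -
    have eq: "indicator B (Z k \<omega>) = (indicator A \<omega> :: real)" if "\<omega> \<in> space M" for \<omega>
      using that by (auto simp: A_def Z_def indicator_def)
    have "integrable M (indicator A :: _ \<Rightarrow> real)"
      using A by (intro integrable_real_indicator) (simp_all add: less_top[symmetric])
    moreover have "integrable M (\<lambda>\<omega>. indicator B (Z k \<omega>) :: real) \<longleftrightarrow> integrable M (indicator A :: _ \<Rightarrow> real)"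
      by (intro Bochner_Integration.integrable_cong refl eq)
    ultimately show "integrable M (\<lambda>\<omega>. indicator B (Z k \<omega>) :: real)"
      by (simp only:)
    have "(\<integral>\<omega>. (indicator B (Z k \<omega>) :: real) \<partial>M) = (\<integral>\<omega>. indicator A \<omega> \<partial>M)"
      by (intro Bochner_Integration.integral_cong refl eq)
    also have "\<dots> = measure M A"
      using A by simp
    finally show "(\<integral>\<omega>. (indicator B (Z k \<omega>) :: real) \<partial>M) = measure M A" .
  qed
  show "integrable M (\<lambda>\<omega>. indicator B (I k \<omega>, Q k \<omega>) * h (sample_history I Q \<eta> k \<omega>))"
    using indep_var_integrable[OF ind int2 int1] by (simp add: Z_def)
  show "(\<integral>\<omega>. indicator B (I k \<omega>, Q k \<omega>) * h (sample_history I Q \<eta> k \<omega>) \<partial>M)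
      = measure M {\<omega> \<in> space M. (I k \<omega>, Q k \<omega>) \<in> B} * (\<integral>\<omega>. h (sample_history I Q \<eta> k \<omega>) \<partial>M)"
    using indep_var_lebesgue_integral[OF ind int2 int1] eq2 by (simp add: Z_def A_def)
qed

lemma
  fixes \<psi> :: "'a::euclidean_space \<times> (nat \<Rightarrow> 'a) \<Rightarrow> real"
    and n f g p lam \<eta> x0 xhat I Q
  assumes samp: "lsvrg_sampling M n p I Q"
  defines "state \<equiv> \<lambda>k \<omega>. lsvrg n f g p lam \<eta> x0 xhat (\<lambda>j. I j \<omega>) (\<lambda>j. Q j \<omega>) k"
  shows integrable_lsvrg: "integrable M (\<lambda>\<omega>. \<psi> (state k \<omega>))"
    and fresh_sample_lsvrg_integrable: "B \<in> sets (count_space {1..n} \<Otimes>\<^sub>M borel) \<Longrightarrow>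
      integrable M (\<lambda>\<omega>. indicator B (I k \<omega>, Q k \<omega>) * \<psi> (state k \<omega>))"
    and fresh_sample_lsvrg_integral: "B \<in> sets (count_space {1..n} \<Otimes>\<^sub>M borel) \<Longrightarrow>
      (\<integral>\<omega>. indicator B (I k \<omega>, Q k \<omega>) * \<psi> (state k \<omega>) \<partial>M)
        = measure M {\<omega> \<in> space M. (I k \<omega>, Q k \<omega>) \<in> B} * (\<integral>\<omega>. \<psi> (state k \<omega>) \<partial>M)"
proof -
  obtain h where h: "\<forall>\<omega>. state k \<omega> = h (sample_history I Q \<eta> k \<omega>)"
    using lsvrg_factors_through_sample_history unfolding state_def by blast
  show "integrable M (\<lambda>\<omega>. \<psi> (state k \<omega>))"
    unfolding h[rule_format] by (rule integrable_sample_history[OF samp])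
  assume B: "B \<in> sets (count_space {1..n} \<Otimes>\<^sub>M borel)"
  show "integrable M (\<lambda>\<omega>. indicator B (I k \<omega>, Q k \<omega>) * \<psi> (state k \<omega>))"
    unfolding h[rule_format] by (rule fresh_sample_integrable[OF samp B])
  show "(\<integral>\<omega>. indicator B (I k \<omega>, Q k \<omega>) * \<psi> (state k \<omega>) \<partial>M)
      = measure M {\<omega> \<in> space M. (I k \<omega>, Q k \<omega>) \<in> B} * (\<integral>\<omega>. \<psi> (state k \<omega>) \<partial>M)"
    unfolding h[rule_format] by (rule fresh_sample_integral[OF samp B])
qed

lemma prob_dual_update:
  assumes samp: "lsvrg_sampling M n p I Q" and "0 < \<eta>" "\<eta> \<le> 1"
  shows "measure M {\<omega> \<in> space M. Q k \<omega> < \<eta>} = \<eta>"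
proof -
  interpret prob_space M
    using samp by (simp add: lsvrg_sampling_def)
  have "(\<lambda>\<omega>. (I k \<omega>, Q k \<omega>)) \<in> measurable M (count_space {1..n} \<Otimes>\<^sub>M borel)"
    and distr: "distr M borel (Q k) = uniform_measure lborel {0..1}"
    using samp by (auto simp: lsvrg_sampling_def indep_vars_def)
  then have Q: "Q k \<in> borel_measurable M"
    using measurable_compose[OF _ measurable_snd] by fastforce
  have "{\<omega> \<in> space M. Q k \<omega> < \<eta>} = Q k -` {..<\<eta>} \<inter> space M"
    by auto
  then have "measure M {\<omega> \<in> space M. Q k \<omega> < \<eta>} = measure (distr M borel (Q k)) {..<\<eta>}"
    using Q by (simp add: measure_distr)
  also have "\<dots> = measure lborel ({0..1} \<inter> {..<\<eta>})"
    unfolding distr by (subst measure_uniform_measure) auto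
  also have "{0..1} \<inter> {..<\<eta>} = {0..<\<eta>}"
    using assms by auto
  finally show ?thesis
    using \<open>0 < \<eta>\<close> by simp
qed


section \<open>Contraction of the Lyapunov function\<close>

definition primal_step ::
  "nat \<Rightarrow> (nat \<Rightarrow> 'a::euclidean_space \<Rightarrow> real) \<Rightarrow> ('a \<Rightarrow> ereal) \<Rightarrow> (nat \<Rightarrow> real) \<Rightarrow> real \<Rightarrow>
   nat \<Rightarrow> 'a \<times> (nat \<Rightarrow> 'a) \<Rightarrow> 'a" where
  "primal_step n f g p lam i s = prox lam g (fst s - (lam / real n) *\<^sub>R
     ((1 / p i) *\<^sub>R (grad (f i) (fst s) - snd s i) + (\<Sum>j\<in>{1..n}. snd s j)))"

definition dual_variance ::
  "nat \<Rightarrow> (nat \<Rightarrow> 'a::euclidean_space \<Rightarrow> real) \<Rightarrow> (nat \<Rightarrow> real) \<Rightarrow> 'a \<Rightarrow> (nat \<Rightarrow> 'a) \<Rightarrow> real" where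
  "dual_variance n f p xs y = wvar p {1..n} (\<lambda>i. (1 / (real n * p i)) *\<^sub>R (y i - grad (f i) xs))"

lemma lsvrg_Suc:
  fixes n f g p lam \<eta> x0 xhat i q k
  defines "s \<equiv> lsvrg n f g p lam \<eta> x0 xhat i q k"
  shows "lsvrg n f g p lam \<eta> x0 xhat i q (Suc k)
    = (primal_step n f g p lam (i k) s, if q k < \<eta> then (\<lambda>j. grad (f j) (fst s)) else snd s)"
  by (simp add: s_def primal_step_def Let_def split_beta)

text \<open>The Lyapunov function is the squared error of the iterate plus \<open>c\<close> times the dual variance, and
  the left-hand side is its conditional expectation after one step from state \<open>s\<close>: the dual points
  are refreshed together, so their variance is that of the current gradients with probability \<open>\<eta>\<close>
  and the old one otherwise.  By optimality, \<open>xs\<close> is the proximal point of its own exact gradient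
  step, so the proximal operator can be dropped and the inequality for the gradient step remains.\<close>

lemma lsvrg_drift:
  fixes f :: "nat \<Rightarrow> 'a::euclidean_space \<Rightarrow> real"
  assumes "n \<ge> 1" and problem: "problem_properties n f g L LF \<mu>" and "0 < \<eta>"
    and p: "\<And>i. i \<in> {1..n} \<Longrightarrow> 0 < p i" "sum p {1..n} = 1"
    and lam: "0 < lam" "\<mu> * lam < \<eta>" "nu \<mu> \<eta> (weighted_max n L p) (\<mu> * lam) * lam \<le> 1"
    and sol: "is_solution n f g xs"
    and r: "r = sqrt (\<eta> / (\<eta> - \<mu> * lam))"
    and c: "c = lam\<^sup>2 * (1 + 1 / r) / (\<eta> - \<mu> * lam)"
  shows "(\<Sum>i\<in>{1..n}. p i * (norm (primal_step n f g p lam i s - xs))\<^sup>2)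
      + c * (\<eta> * dual_variance n f p xs (\<lambda>j. grad (f j) (fst s)) + (1 - \<eta>) * dual_variance n f p xs (snd s))
    \<le> (1 - \<mu> * lam) * ((norm (fst s - xs))\<^sup>2 + c * dual_variance n f p xs (snd s))"
proof -
  obtain x y where s: "s = (x, y)" by (cases s)
  define F where "F = avg_fun n f"
  define a where "a = (\<lambda>i. (1 / (real n * p i)) *\<^sub>R (grad (f i) x - grad (f i) xs))"
  define b where "b = (\<lambda>i. (1 / (real n * p i)) *\<^sub>R (y i - grad (f i) xs))"
  have g: "closed_convex_proper g" and smooth: "\<And>i. i \<in> {1..n} \<Longrightarrow> smooth_fun (L i) (f i)"
    and sc: "strongly_convex \<mu> F" and smoothF: "smooth_fun LF F"
    using problem by (auto simp: problem_properties_def F_def)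
  have "\<mu> > 0" using sc by (simp add: strongly_convex_def)
  have diffF: "F differentiable (at z)" for z
    using smoothF by (simp add: smooth_fun_def)
  have "f i differentiable (at z)" if "i \<in> {1..n}" for i z
    using smooth[OF that] by (simp add: smooth_fun_def)
  then have gradF: "grad F z = (1 / real n) *\<^sub>R (\<Sum>i\<in>{1..n}. grad (f i) z)" for z
    unfolding F_def by (rule grad_avg_fun)
  have mean: "wmean p {1..n} (\<lambda>i. (1 / (real n * p i)) *\<^sub>R u i) = (1 / real n) *\<^sub>R (\<Sum>i\<in>{1..n}. u i)"
    for u :: "nat \<Rightarrow> 'a"
    unfolding wmean_def scaleR_sum_right
    by (intro sum.cong refl) (use p(1) \<open>n \<ge> 1\<close> in \<open>force\<close>)
  have mean_a: "wmean p {1..n} a = grad F x - grad F xs"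
    unfolding a_def mean gradF by (simp add: sum_subtractf scaleR_diff_right)
  have mean_b: "wmean p {1..n} b = (1 / real n) *\<^sub>R (\<Sum>i\<in>{1..n}. y i) - grad F xs"
    unfolding b_def mean gradF by (simp add: sum_subtractf scaleR_diff_right)
  have sub: "subgradient g xs (- grad F xs)"
    using sol GDERIV_grad[OF diffF] unfolding is_solution_def F_def
    by (intro minimiser_imp_subgradient[OF g])
  have "norm (primal_step n f g p lam i s - xs)
      \<le> norm ((x - xs) - lam *\<^sub>R (a i - b i + wmean p {1..n} b))" for i
  proof -
    have "(x - (lam / real n) *\<^sub>R ((1 / p i) *\<^sub>R (grad (f i) x - y i) + (\<Sum>j\<in>{1..n}. y j)))
        - (xs + lam *\<^sub>R (- grad F xs)) = (x - xs) - lam *\<^sub>R (a i - b i + wmean p {1..n} b)"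
      unfolding mean_b by (simp add: a_def b_def algebra_simps)
    then show ?thesis
      using prox_nonexpansive_at[OF g lam(1) sub] unfolding primal_step_def s fst_conv snd_conv
      by metis
  qed
  then have "(\<Sum>i\<in>{1..n}. p i * (norm (primal_step n f g p lam i s - xs))\<^sup>2)
      \<le> (\<Sum>i\<in>{1..n}. p i * (norm ((x - xs) - lam *\<^sub>R (a i - b i + wmean p {1..n} b)))\<^sup>2)"
    using p(1) by (intro sum_mono mult_left_mono power_mono) (auto intro: less_imp_le)
  moreover have "(\<Sum>i\<in>{1..n}. p i * (norm ((x - xs) - lam *\<^sub>R (a i - b i + wmean p {1..n} b)))\<^sup>2)
      + c * (\<eta> * wvar p {1..n} a + (1 - \<eta>) * wvar p {1..n} b)
    \<le> (1 - \<mu> * lam) * ((norm (x - xs))\<^sup>2 + c * wvar p {1..n} b)"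
  proof (rule svrg_step_inequality[OF _ p(2) \<open>\<mu> > 0\<close> lam(1) \<open>0 < \<eta>\<close> lam(2,3) refl _ _ r c])
    show "0 \<le> p i" if "i \<in> {1..n}" for i
      using p(1)[OF that] by simp
    show "(\<Sum>i\<in>{1..n}. p i * (norm (a i))\<^sup>2) \<le> weighted_max n L p * inner (wmean p {1..n} a) (x - xs)"
      unfolding mean_a unfolding a_def F_def
      by (intro weighted_cocoercivity \<open>n \<ge> 1\<close> p(1) smooth)
    show "\<mu> * (norm (x - xs))\<^sup>2 \<le> inner (wmean p {1..n} a) (x - xs)"
      unfolding mean_a by (rule strongly_convex_strongly_monotone[OF sc diffF])
  qed
  ultimately show ?thesis
    by (simp add: s dual_variance_def a_def[symmetric] b_def[symmetric])
qed

text \<open>The Lyapunov function after a step is a sum of terms, each of them the indicator of an event of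
  the fresh sample times a function of the state before the step.  Independence turns the
  indicators into probabilities, after which the drift inequality applies pointwise.\<close>

theorem lsvrg_mean_square_rate:
  fixes f :: "nat \<Rightarrow> 'a::euclidean_space \<Rightarrow> real"
  assumes "n \<ge> 1" and problem: "problem_properties n f g L LF \<mu>" and eta: "0 < \<eta>" "\<eta> \<le> 1"
    and sum: "sum p {1..n} = 1"
    and lam: "0 < lam" "\<mu> * lam < \<eta>" "nu \<mu> \<eta> (weighted_max n L p) (\<mu> * lam) * lam \<le> 1"
    and sol: "is_solution n f g xs"
    and samp: "lsvrg_sampling M n p I Q"
  shows "mean_square_rate M (lsvrg_iterate n f g p lam \<eta> x0 xhat I Q) xs (1 - \<mu> * lam)"
proof -
  interpret prob_space M
    using samp by (simp add: lsvrg_sampling_def)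
  have p: "\<And>i. i \<in> {1..n} \<Longrightarrow> 0 < p i"
    and prob_I: "\<And>k i. i \<in> {1..n} \<Longrightarrow> measure M {\<omega> \<in> space M. I k \<omega> = i} = p i"
    and IQ: "\<And>k. (\<lambda>\<omega>. (I k \<omega>, Q k \<omega>)) \<in> measurable M (count_space {1..n} \<Otimes>\<^sub>M borel)"
    using samp by (auto simp: lsvrg_sampling_def indep_vars_def)
  have I: "I k \<omega> \<in> {1..n}" if "\<omega> \<in> space M" for k \<omega>
    using measurable_space[OF IQ that, of k] by (simp add: space_pair_measure)
  have Q: "Q k \<in> borel_measurable M" for k
    using measurable_compose[OF IQ measurable_snd] by simp
  define r where "r = sqrt (\<eta> / (\<eta> - \<mu> * lam))"
  define c where "c = lam\<^sup>2 * (1 + 1 / r) / (\<eta> - \<mu> * lam)"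
  define V where "V = (\<lambda>s. (norm (fst s - xs))\<^sup>2 + c * dual_variance n f p xs (snd s))"
  define state where "state = (\<lambda>k \<omega>. lsvrg n f g p lam \<eta> x0 xhat (\<lambda>j. I j \<omega>) (\<lambda>j. Q j \<omega>) k)"
  define primal where "primal = (\<lambda>i s. (norm (primal_step n f g p lam i s - xs))\<^sup>2)"
  define fresh where "fresh = (\<lambda>s :: 'a \<times> (nat \<Rightarrow> 'a). c * dual_variance n f p xs (\<lambda>j. grad (f j) (fst s)))"
  define old where "old = (\<lambda>s :: 'a \<times> (nat \<Rightarrow> 'a). c * dual_variance n f p xs (snd s))"
  have "r \<ge> 0" using eta lam by (simp add: r_def)
  then have "c \<ge> 0" using lam by (simp add: c_def)
  have dual_nonneg: "0 \<le> c * dual_variance n f p xs y" for y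
    using \<open>c \<ge> 0\<close> p unfolding dual_variance_def
    by (intro mult_nonneg_nonneg wvar_nonneg) (auto intro: less_imp_le)
  have int [simp]: "integrable M (\<lambda>\<omega>. \<psi> (state k \<omega>))" for \<psi> :: "_ \<Rightarrow> real" and k
    unfolding state_def by (rule integrable_lsvrg[OF samp])
  have int_fresh: "integrable M (\<lambda>\<omega>. indicator B (I k \<omega>, Q k \<omega>) * \<psi> (state k \<omega>))"
    and integral_fresh: "(\<integral>\<omega>. indicator B (I k \<omega>, Q k \<omega>) * \<psi> (state k \<omega>) \<partial>M)
        = measure M {\<omega> \<in> space M. (I k \<omega>, Q k \<omega>) \<in> B} * (\<integral>\<omega>. \<psi> (state k \<omega>) \<partial>M)"
    if "B \<in> sets (count_space {1..n} \<Otimes>\<^sub>M borel)" for B k and \<psi> :: "_ \<Rightarrow> real"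
    unfolding state_def
    using fresh_sample_lsvrg_integrable[OF samp that] fresh_sample_lsvrg_integral[OF samp that] by blast+
  define Bi where "Bi = (\<lambda>i :: nat. {i} \<times> (UNIV :: real set))"
  define Bnew where "Bnew = {1..n} \<times> {..<\<eta>}"
  define Bold where "Bold = {1..n} \<times> {\<eta>..}"
  have sets: "Bi i \<in> sets (count_space {1..n} \<Otimes>\<^sub>M borel)" if "i \<in> {1..n}" for i
    unfolding Bi_def using that by (intro pair_measureI) auto
  have sets': "Bnew \<in> sets (count_space {1..n} \<Otimes>\<^sub>M borel)" "Bold \<in> sets (count_space {1..n} \<Otimes>\<^sub>M borel)"
    unfolding Bnew_def Bold_def by (auto intro!: pair_measureI)
  have prob_Bi: "measure M {\<omega> \<in> space M. (I k \<omega>, Q k \<omega>) \<in> Bi i} = p i" if "i \<in> {1..n}" for i k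
    using prob_I[OF that] by (simp add: Bi_def)
  have prob_new: "measure M {\<omega> \<in> space M. (I k \<omega>, Q k \<omega>) \<in> Bnew} = \<eta>" for k
  proof -
    have "{\<omega> \<in> space M. (I k \<omega>, Q k \<omega>) \<in> Bnew} = {\<omega> \<in> space M. Q k \<omega> < \<eta>}"
      using I by (auto simp: Bnew_def)
    then show ?thesis
      using prob_dual_update[OF samp eta] by simp
  qed
  have prob_old: "measure M {\<omega> \<in> space M. (I k \<omega>, Q k \<omega>) \<in> Bold} = 1 - \<eta>" for k
  proof -
    have "{\<omega> \<in> space M. (I k \<omega>, Q k \<omega>) \<in> Bold} = space M - {\<omega> \<in> space M. Q k \<omega> < \<eta>}"
      using I by (auto simp: Bold_def not_less)
    moreover have "{\<omega> \<in> space M. Q k \<omega> < \<eta>} \<in> events"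
      using Q[of k] by measurable
    ultimately show ?thesis
      using prob_dual_update[OF samp eta] by (simp add: prob_compl)
  qed
  have V_Suc: "V (state (Suc k) \<omega>)
      = (\<Sum>i\<in>{1..n}. indicator (Bi i) (I k \<omega>, Q k \<omega>) * primal i (state k \<omega>))
        + (indicator Bnew (I k \<omega>, Q k \<omega>) * fresh (state k \<omega>) + indicator Bold (I k \<omega>, Q k \<omega>) * old (state k \<omega>))"
    if "\<omega> \<in> space M" for k \<omega>
  proof -
    have "(\<Sum>i\<in>{1..n}. indicator (Bi i) (I k \<omega>, Q k \<omega>) * primal i (state k \<omega>))
        = (\<Sum>i\<in>{1..n}. if i = I k \<omega> then primal i (state k \<omega>) else 0)"
      by (intro sum.cong) (auto simp: Bi_def indicator_def)
    also have "\<dots> = primal (I k \<omega>) (state k \<omega>)"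
      using I[OF that, of k] by (simp del: One_nat_def)
    finally have "(\<Sum>i\<in>{1..n}. indicator (Bi i) (I k \<omega>, Q k \<omega>) * primal i (state k \<omega>))
        = primal (I k \<omega>) (state k \<omega>)" .
    then show ?thesis
      using I[OF that, of k]
      by (simp add: V_def state_def lsvrg_Suc primal_def fresh_def old_def Bnew_def Bold_def indicator_def
          del: lsvrg.simps)
  qed
  have step: "(\<integral>\<omega>. V (state (Suc k) \<omega>) \<partial>M) \<le> (1 - \<mu> * lam) * (\<integral>\<omega>. V (state k \<omega>) \<partial>M)" for k
  proof -
    have "(\<integral>\<omega>. V (state (Suc k) \<omega>) \<partial>M)
        = (\<integral>\<omega>. (\<Sum>i\<in>{1..n}. indicator (Bi i) (I k \<omega>, Q k \<omega>) * primal i (state k \<omega>))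
        + (indicator Bnew (I k \<omega>, Q k \<omega>) * fresh (state k \<omega>) + indicator Bold (I k \<omega>, Q k \<omega>) * old (state k \<omega>)) \<partial>M)"
      by (intro Bochner_Integration.integral_cong refl V_Suc)
    also have "\<dots> = (\<Sum>i\<in>{1..n}. p i * (\<integral>\<omega>. primal i (state k \<omega>) \<partial>M))
        + (\<eta> * (\<integral>\<omega>. fresh (state k \<omega>) \<partial>M) + (1 - \<eta>) * (\<integral>\<omega>. old (state k \<omega>) \<partial>M))"
    proof -
      have "(\<integral>\<omega>. (\<Sum>i\<in>{1..n}. indicator (Bi i) (I k \<omega>, Q k \<omega>) * primal i (state k \<omega>)) \<partial>M)
          = (\<Sum>i\<in>{1..n}. \<integral>\<omega>. indicator (Bi i) (I k \<omega>, Q k \<omega>) * primal i (state k \<omega>) \<partial>M)"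
        by (intro Bochner_Integration.integral_sum int_fresh sets)
      also have "\<dots> = (\<Sum>i\<in>{1..n}. p i * (\<integral>\<omega>. primal i (state k \<omega>) \<partial>M))"
        by (intro sum.cong refl) (simp only: integral_fresh[OF sets] prob_Bi)
      finally have sum_eq: "(\<integral>\<omega>. (\<Sum>i\<in>{1..n}. indicator (Bi i) (I k \<omega>, Q k \<omega>) * primal i (state k \<omega>)) \<partial>M)
          = (\<Sum>i\<in>{1..n}. p i * (\<integral>\<omega>. primal i (state k \<omega>) \<partial>M))" .
      show ?thesis
        by (subst Bochner_Integration.integral_add, intro Bochner_Integration.integrable_sum int_fresh sets,
            assumption, intro Bochner_Integration.integrable_add int_fresh sets',
            subst Bochner_Integration.integral_add, intro int_fresh sets', intro int_fresh sets',
            simp only: sum_eq integral_fresh[OF sets'(1)] integral_fresh[OF sets'(2)] prob_new prob_old)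
    qed
    also have "\<dots> = (\<integral>\<omega>. (\<Sum>i\<in>{1..n}. p i * primal i (state k \<omega>))
        + (\<eta> * fresh (state k \<omega>) + (1 - \<eta>) * old (state k \<omega>)) \<partial>M)"
      by simp
    also have "\<dots> \<le> (\<integral>\<omega>. (1 - \<mu> * lam) * V (state k \<omega>) \<partial>M)"
    proof (rule integral_mono)
      show "(\<Sum>i\<in>{1..n}. p i * primal i (state k \<omega>)) + (\<eta> * fresh (state k \<omega>) + (1 - \<eta>) * old (state k \<omega>))
          \<le> (1 - \<mu> * lam) * V (state k \<omega>)" for \<omega>
        using lsvrg_drift[OF \<open>n \<ge> 1\<close> problem eta(1) p sum lam sol r_def c_def, of "state k \<omega>"]
        by (simp add: primal_def fresh_def old_def V_def algebra_simps)
    qed simp_all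
    finally show ?thesis by simp
  qed
  define v0 where "v0 = (\<integral>\<omega>. V (state 0 \<omega>) \<partial>M)"
  have "\<mu> * lam < 1" using lam eta by linarith
  have bound: "(\<integral>\<omega>. V (state k \<omega>) \<partial>M) \<le> (1 - \<mu> * lam) ^ k * v0" for k
  proof (induction k)
    case (Suc k)
    have "(1 - \<mu> * lam) * (\<integral>\<omega>. V (state k \<omega>) \<partial>M) \<le> (1 - \<mu> * lam) * ((1 - \<mu> * lam) ^ k * v0)"
      using Suc \<open>\<mu> * lam < 1\<close> by (intro mult_left_mono) auto
    then show ?case
      using step[of k] by simp
  qed (simp add: v0_def)
  have iterate: "lsvrg_iterate n f g p lam \<eta> x0 xhat I Q k \<omega> = fst (state k \<omega>)" for k \<omega>
    by (simp add: lsvrg_iterate_def state_def)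
  have int_norm: "integrable M (\<lambda>\<omega>. (norm (fst (state k \<omega>) - xs))\<^sup>2)" for k
    using int[of "\<lambda>s. (norm (fst s - xs))\<^sup>2" k] .
  have "(\<integral>\<omega>. (norm (fst (state k \<omega>) - xs))\<^sup>2 \<partial>M) \<le> v0 * (1 - \<mu> * lam) ^ k" for k
  proof -
    have "(\<integral>\<omega>. (norm (fst (state k \<omega>) - xs))\<^sup>2 \<partial>M) \<le> (\<integral>\<omega>. V (state k \<omega>) \<partial>M)"
      using dual_nonneg by (intro integral_mono int int_norm) (simp add: V_def)
    then show ?thesis
      using bound[of k] by (simp add: mult.commute)
  qed
  then have "(\<lambda>k. \<integral>\<omega>. (norm (fst (state k \<omega>) - xs))\<^sup>2 \<partial>M) \<in> O(\<lambda>k. (1 - \<mu> * lam) ^ k)"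
    using \<open>\<mu> * lam < 1\<close> by (intro bigoI[of _ v0]) auto
  then show ?thesis
    using int_norm by (simp add: mean_square_rate_def iterate)
qed

section \<open>Uniform and importance sampling\<close>

lemma weighted_max_uniform:
  assumes "n \<ge> 1"
  shows "weighted_max n L (\<lambda>i. 1 / real n) = Max (L ` {1..n})"
proof -
  have "L i / (real n * (1 / real n)) = L i" for i
    using assms by simp
  then show ?thesis
    by (simp only: weighted_max_def)
qed

lemma weighted_max_importance:
  assumes "n \<ge> 1" and "\<And>i. i \<in> {1..n} \<Longrightarrow> 0 < L i"
  shows "weighted_max n L (\<lambda>i. L i / (\<Sum>j\<in>{1..n}. L j)) = 1 / real n * (\<Sum>i\<in>{1..n}. L i)"
proof -
  have "L i / (real n * (L i / (\<Sum>j\<in>{1..n}. L j))) = 1 / real n * (\<Sum>i\<in>{1..n}. L i)"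
    if "i \<in> {1..n}" for i
    using assms(2)[OF that] by simp
  then have "(\<lambda>i. L i / (real n * (L i / (\<Sum>j\<in>{1..n}. L j)))) ` {1..n}
      = (\<lambda>i. 1 / real n * (\<Sum>i\<in>{1..n}. L i)) ` {1..n}"
    by (intro image_cong refl)
  also have "\<dots> = {1 / real n * (\<Sum>i\<in>{1..n}. L i)}"
    using \<open>n \<ge> 1\<close> by (intro image_constant[of 1]) simp
  finally show ?thesis
    by (simp only: weighted_max_def Max_singleton)
qed

theorem corollary5p2:
  fixes f :: "nat \<Rightarrow> real ^ 'N \<Rightarrow> real" and g :: "real ^ 'N \<Rightarrow> ereal"
    and n :: nat and L :: "nat \<Rightarrow> real" and LF \<mu> \<eta> :: real
    and Lmax Lbar DU DL lamU lamL :: real and pU pL :: "nat \<Rightarrow> real"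
    and M :: "'w measure" and I :: "nat \<Rightarrow> 'w \<Rightarrow> nat" and Q :: "nat \<Rightarrow> 'w \<Rightarrow> real"
    and x0 xhat :: "real ^ 'N"
  assumes n: "n \<ge> 1"
    and problem: "problem_properties n f g L LF \<mu>"
    and eta: "0 < \<eta>" "\<eta> \<le> 1"
    and Lmax: "Lmax = Max (L ` {1..n})"
    and Lbar: "Lbar = 1 / real n * (\<Sum>i\<in>{1..n}. L i)"
    and DU: "DU = 4 - 3 * (\<mu> / Lmax)"
    and DL: "DL = 4 - 3 * (\<mu> / Lbar)"
    and pU: "pU = (\<lambda>i. 1 / real n)"
    and pL: "pL = (\<lambda>i. L i / (\<Sum>j\<in>{1..n}. L j))"
    and lamU: "lamU = 2 / (DU * Lmax + \<mu> / \<eta> + sqrt ((DU * Lmax)\<^sup>2 + (\<mu> / \<eta>)\<^sup>2))"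
    and lamL: "lamL = 2 / (DL * Lbar + \<mu> / \<eta> + sqrt ((DL * Lbar)\<^sup>2 + (\<mu> / \<eta>)\<^sup>2))"
  shows "4 > DU \<and> DU \<ge> DL \<and> DL \<ge> 1 \<and>
    max_step n L pU \<mu> \<eta> = ereal (2 / (DU * Lmax)) \<and>
    max_step n L pL \<mu> \<eta> = ereal (2 / (DL * Lbar)) \<and>
    (\<exists>!xs. is_solution n f g xs) \<and>
    (\<forall>xs. is_solution n f g xs \<longrightarrow>
       (lsvrg_sampling M n pU I Q \<longrightarrow>
          mean_square_rate M (lsvrg_iterate n f g pU lamU \<eta> x0 xhat I Q) xs (1 - \<mu> * lamU)) \<and>
       (lsvrg_sampling M n pL I Q \<longrightarrow>
          mean_square_rate M (lsvrg_iterate n f g pL lamL \<eta> x0 xhat I Q) xs (1 - \<mu> * lamL)))"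
proof -
  have g: "closed_convex_proper g" and smooth: "\<And>i. i \<in> {1..n} \<Longrightarrow> smooth_fun (L i) (f i)"
    and sc: "strongly_convex \<mu> (avg_fun n f)" and smoothF: "smooth_fun LF (avg_fun n f)"
    and "LF \<le> Lbar"
    using problem by (auto simp: problem_properties_def Lbar)
  have L: "0 < L i" if "i \<in> {1..n}" for i
    using smooth[OF that] by (simp add: smooth_fun_def)
  have "\<mu> > 0" using sc by (simp add: strongly_convex_def)
  have "\<mu> \<le> Lbar"
    using strong_convexity_le_smoothness[OF sc smoothF] \<open>LF \<le> Lbar\<close> by simp
  have "(\<Sum>i\<in>{1..n}. L i) \<le> (\<Sum>i\<in>{1..n}. Lmax)"
    unfolding Lmax by (intro sum_mono Max_ge) auto
  then have "Lbar \<le> Lmax"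
    using n by (simp add: Lbar field_simps)
  have "Lbar > 0" "Lmax > 0"
    using \<open>\<mu> > 0\<close> \<open>\<mu> \<le> Lbar\<close> \<open>Lbar \<le> Lmax\<close> by auto
  have "0 < \<mu> / Lmax" "\<mu> / Lmax \<le> \<mu> / Lbar" "\<mu> / Lbar \<le> 1"
    using \<open>\<mu> > 0\<close> \<open>\<mu> \<le> Lbar\<close> \<open>Lbar \<le> Lmax\<close> \<open>Lbar > 0\<close> \<open>Lmax > 0\<close>
    by (simp_all add: divide_left_mono)
  then have "4 > DU" "DU \<ge> DL" "DL \<ge> 1"
    unfolding DU DL by linarith+
  have DULmax: "DU * Lmax = 4 * Lmax - 3 * \<mu>"
    using \<open>Lmax > 0\<close> by (simp add: DU algebra_simps)
  have DLLbar: "DL * Lbar = 4 * Lbar - 3 * \<mu>"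
    using \<open>Lbar > 0\<close> by (simp add: DL algebra_simps)
  have mU: "weighted_max n L pU = Lmax"
    unfolding pU Lmax using n by (rule weighted_max_uniform)
  have mL: "weighted_max n L pL = Lbar"
    unfolding pL Lbar using n L by (rule weighted_max_importance)
  have sumU: "sum pU {1..n} = 1"
    using n by (simp add: pU)
  have "(\<Sum>i\<in>{1..n}. L i) > 0"
    using n L by (intro sum_pos) auto
  then have sumL: "sum pL {1..n} = 1"
    by (simp add: pL sum_divide_distrib[symmetric])
  have stepU: "max_step n L pU \<mu> \<eta> = ereal (2 / (DU * Lmax))"
    using max_step_eq[OF \<open>\<mu> > 0\<close> eta(1) mU] \<open>\<mu> \<le> Lbar\<close> \<open>Lbar \<le> Lmax\<close> by (simp add: DULmax)
  have stepL: "max_step n L pL \<mu> \<eta> = ereal (2 / (DL * Lbar))"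
    using max_step_eq[OF \<open>\<mu> > 0\<close> eta(1) mL \<open>\<mu> \<le> Lbar\<close>] by (simp add: DLLbar)
  have "\<mu> \<le> Lmax" using \<open>\<mu> \<le> Lbar\<close> \<open>Lbar \<le> Lmax\<close> by simp
  note recU = recommended_step[OF \<open>\<mu> > 0\<close> eta(1) \<open>\<mu> \<le> Lmax\<close> lamU[unfolded DULmax]]
  note recL = recommended_step[OF \<open>\<mu> > 0\<close> eta(1) \<open>\<mu> \<le> Lbar\<close> lamL[unfolded DLLbar]]
  have "\<exists>!xs. is_solution n f g xs"
    using smoothF by (intro ex1_solution[OF g sc]) (simp add: smooth_fun_def)
  moreover have "mean_square_rate M (lsvrg_iterate n f g pU lamU \<eta> x0 xhat I Q) xs (1 - \<mu> * lamU)"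
    if "is_solution n f g xs" "lsvrg_sampling M n pU I Q" for xs
    using lsvrg_mean_square_rate[OF n problem eta sumU recU(1,2) _ that] recU(3) by (simp only: mU)
  moreover have "mean_square_rate M (lsvrg_iterate n f g pL lamL \<eta> x0 xhat I Q) xs (1 - \<mu> * lamL)"
    if "is_solution n f g xs" "lsvrg_sampling M n pL I Q" for xs
    using lsvrg_mean_square_rate[OF n problem eta sumL recL(1,2) _ that] recL(3) by (simp only: mL)
  ultimately show ?thesis
    using \<open>4 > DU\<close> \<open>DU \<ge> DL\<close> \<open>DL \<ge> 1\<close> stepU stepL by blast
qed

end
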